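(* Let $n=2d$, let $H:\mathbb{R}^{n}\to\mathbb{R}$, and consider the canonical Hamiltonian system $$\dot x = S\nabla H(x),\qquad S=\begin{bmatrix}0&I\\-I&0\end{bmatrix}\in\mathbb{R}^{2d\times 2d}.$$ Let $\overline\nabla H:\mathbb{R}^n\times\mathbb{R}^n\to\mathbb{R}^n$ be a second-order symmetric discrete gradient of $H$. Let $$Q(x,\hat x):=\tfrac12\big(D_2\overline\nabla H(x,\hat x)^T-D_2\overline\nabla H(x,\hat x)\big),\qquad \bar x:=\frac{x+\hat x}{2},$$ and let $S_4(x,\hat x,h)$ be the skew-symmetric matrix $$S_4(x,\hat x,h)=S+\frac h2\,S\Big[Q\big(x,\tfrac{x+2\hat x}{3}\big)-Q\big(\hat x,\tfrac{2x+\hat x}{3}\big)\Big]S-\frac{h^2}{12}\,S\,\nabla^2H(\bar x)\,S\,\nabla^2H(\bar x)\,S .$$ Then the discrete gradient method $$\hat x=x+h\,S_4(x,\hat x,h)\,\overline\nabla H(x,\hat x)$$ is of fourth order.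
   Context: $I$ is the $d\times d$ identity matrix; $\nabla^2 H$ is the Hessian of $H$; $D_2\overline\nabla H(x,\hat x)$ is the Jacobian matrix of $\overline\nabla H$ with respect to its second argument, with $(i,j)$ entry $\partial[\overline\nabla H(x,\hat x)]_i/\partial\hat x_j$. A discrete gradient of $H$ is a function $\overline\nabla H:\mathbb{R}^n\times\mathbb{R}^n\to\mathbb{R}^n$ such that $\overline\nabla H(x,\hat x)^T(\hat x-x)=H(\hat x)-H(x)$ and $\overline\nabla H(x,x)=\nabla H(x)$ for all $x,\hat x$. It is symmetric if $\overline\nabla H(x,\hat x)=\overline\nabla H(\hat x,x)$ for all $x,\hat x$. It is second-order if the associated method $\hat x=x+hS\,\overline\nabla H(x,\hat x)$ is of order 2. A one-step method $x\mapsto\hat x$ with step size $h$ (here defined implicitly for small $h$, $\hat x$ being the solution close to $x$) is of order $p$ if its local error satisfies $\hat x-x(t+h)=\mathcal{O}(h^{p+1})$ as $h\to0$, where $x(\cdot)$ is the exact solution of the ODE with $x(t)=x$. As usual when speaking of order, $H$ and $\overline\nabla H$ are assumed to be sufficiently many times continuously differentiable. *)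

theory Defs
  imports "HOL-Analysis.Analysis" "HOL-Library.Landau_Symbols"
begin

section \<open>Smoothness, gradient and Hessian\<close>

text \<open>\<open>C_k k f\<close>: \<open>f\<close> is \<open>k\<close> times continuously differentiable on the whole
  (finite-dimensional) space. Quantifying over all directions \<open>v\<close> is the same as requiring
  this of all partial derivatives.\<close>

primrec C_k :: "nat \<Rightarrow> ('a::euclidean_space \<Rightarrow> 'b::real_normed_vector) \<Rightarrow> bool" where
  "C_k 0 f \<longleftrightarrow> continuous_on UNIV f"
| "C_k (Suc k) f \<longleftrightarrow>
     (\<forall>x. f differentiable (at x)) \<and> (\<forall>v. C_k k (\<lambda>x. frechet_derivative f (at x) v))"

text \<open>Meaningful where \<open>H\<close> is differentiable; the gradient vector is then unique.\<close>

definition grad :: "('a::euclidean_space \<Rightarrow> real) \<Rightarrow> 'a \<Rightarrow> 'a" where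
  "grad H x = (THE D. GDERIV H x :> D)"

definition hessian :: "(real^'n \<Rightarrow> real) \<Rightarrow> real^'n \<Rightarrow> real^'n^'n" where
  "hessian H x = jacobian (grad H) (at x)"

section \<open>One-step methods and their order\<close>

definition local_solution :: "('a::real_normed_vector \<Rightarrow> 'a) \<Rightarrow> (real \<Rightarrow> 'a) \<Rightarrow> real \<Rightarrow> 'a \<Rightarrow> bool" where
  "local_solution f y t x \<longleftrightarrow>
     y t = x \<and> (\<forall>\<^sub>F s in nhds t. (y has_vector_derivative f (y s)) (at s))"

text \<open>An implicit one-step method is given by the relation \<open>M x z h\<close>: \<open>z\<close> solves the
  equation of the step of size \<open>h\<close> from \<open>x\<close>. \<open>numerical_step M x \<phi>\<close> says that, for small \<open>h\<close>,
  \<open>\<phi> h\<close> is the solution close to \<open>x\<close>: it exists, it is the only one in a fixed ball around \<open>x\<close>,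
  and it tends to \<open>x\<close>.\<close>

definition numerical_step ::
    "('a::real_normed_vector \<Rightarrow> 'a \<Rightarrow> real \<Rightarrow> bool) \<Rightarrow> 'a \<Rightarrow> (real \<Rightarrow> 'a) \<Rightarrow> bool" where
  "numerical_step M x \<phi> \<longleftrightarrow>
     (\<phi> \<longlongrightarrow> x) (at 0) \<and>
     (\<exists>r>0. \<forall>\<^sub>F h in at 0.
        \<phi> h \<in> ball x r \<and> M x (\<phi> h) h \<and> (\<forall>z\<in>ball x r. M x z h \<longrightarrow> z = \<phi> h))"

text \<open>Order (at least) \<open>p\<close> for \<open>y' = f y\<close>: from every \<open>x\<close> the step is well defined for small
  \<open>h\<close>, and its local error against any exact solution through \<open>x\<close> is \<open>O(h\<^sup>p\<^sup>+\<^sup>1)\<close> as \<open>h \<rightarrow> 0\<close>.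
  Solutions are local in time, since \<open>f\<close> need not be globally Lipschitz.\<close>

definition has_order ::
    "('a::real_normed_vector \<Rightarrow> 'a) \<Rightarrow> ('a \<Rightarrow> 'a \<Rightarrow> real \<Rightarrow> bool) \<Rightarrow> nat \<Rightarrow> bool" where
  "has_order f M p \<longleftrightarrow>
     (\<forall>x. \<exists>\<phi>. numerical_step M x \<phi> \<and>
        (\<forall>t y. local_solution f y t x \<longrightarrow>
           (\<lambda>h. norm (\<phi> h - y (t + h))) \<in> O[at 0](\<lambda>h. h ^ (p + 1))))"

section \<open>Discrete gradients\<close>

definition discrete_gradient :: "('a::euclidean_space \<Rightarrow> real) \<Rightarrow> ('a \<Rightarrow> 'a \<Rightarrow> 'a) \<Rightarrow> bool" where
  "discrete_gradient H DG \<longleftrightarrow>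
     (\<forall>x z. DG x z \<bullet> (z - x) = H z - H x) \<and> (\<forall>x. DG x x = grad H x)"

definition symmetric_dg :: "('a \<Rightarrow> 'a \<Rightarrow> 'b) \<Rightarrow> bool" where
  "symmetric_dg DG \<longleftrightarrow> (\<forall>x z. DG x z = DG z x)"

text \<open>The step equation \<open>z = x + h A(x,z,h) DG(x,z)\<close>.\<close>

definition dg_method ::
    "(real^'n \<Rightarrow> real^'n \<Rightarrow> real \<Rightarrow> real^'n^'n) \<Rightarrow> (real^'n \<Rightarrow> real^'n \<Rightarrow> real^'n)
      \<Rightarrow> real^'n \<Rightarrow> real^'n \<Rightarrow> real \<Rightarrow> bool" where
  "dg_method A DG x z h \<longleftrightarrow> z = x + h *\<^sub>R (A x z h *v DG x z)"

definition second_order_dg ::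
    "real^'n^'n \<Rightarrow> (real^'n \<Rightarrow> real) \<Rightarrow> (real^'n \<Rightarrow> real^'n \<Rightarrow> real^'n) \<Rightarrow> bool" where
  "second_order_dg S H DG \<longleftrightarrow>
     has_order (\<lambda>x. S *v grad H x) (dg_method (\<lambda>x z h. S) DG) 2"

definition D2 :: "(real^'n \<Rightarrow> real^'n \<Rightarrow> real^'n) \<Rightarrow> real^'n \<Rightarrow> real^'n \<Rightarrow> real^'n^'n" where
  "D2 DG x z = jacobian (DG x) (at z)"

definition Q_mat :: "(real^'n \<Rightarrow> real^'n \<Rightarrow> real^'n) \<Rightarrow> real^'n \<Rightarrow> real^'n \<Rightarrow> real^'n^'n" where
  "Q_mat DG x z = (1/2) *\<^sub>R (transpose (D2 DG x z) - D2 DG x z)"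

section \<open>The canonical structure matrix and its fourth-order modification\<close>

text \<open>\<open>\<real>\<^sup>2\<^sup>d\<close> is \<open>real^('d + 'd)\<close>: \<open>Inl\<close> and \<open>Inr\<close> index the first and the second block of \<open>d\<close>
  coordinates.\<close>

definition canonical_S :: "real^('d::finite + 'd)^('d + 'd)" where
  "canonical_S = (\<chi> i j. case (i, j) of
       (Inl a, Inr b) \<Rightarrow> if a = b then 1 else 0
     | (Inr a, Inl b) \<Rightarrow> if a = b then -1 else 0
     | _ \<Rightarrow> 0)"

definition S4 ::
    "real^'n^'n \<Rightarrow> (real^'n \<Rightarrow> real) \<Rightarrow> (real^'n \<Rightarrow> real^'n \<Rightarrow> real^'n)
      \<Rightarrow> real^'n \<Rightarrow> real^'n \<Rightarrow> real \<Rightarrow> real^'n^'n" where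
  "S4 S H DG x z h =
     S
     + (h / 2) *\<^sub>R (S ** (Q_mat DG x ((1/3) *\<^sub>R (x + 2 *\<^sub>R z))
                        - Q_mat DG z ((1/3) *\<^sub>R (2 *\<^sub>R x + z))) ** S)
     - (h\<^sup>2 / 12) *\<^sub>R (S ** hessian H ((1/2) *\<^sub>R (x + z)) ** S
                          ** hessian H ((1/2) *\<^sub>R (x + z)) ** S)"

end

theory Submission
  imports Defs
begin

text \<open>
  Write \<open>v = z - x\<close> for the chord of a step, \<open>m\<close> for its midpoint, \<open>F = S grad H\<close> for the vector
  field, and \<open>\<Delta>\<close> for the difference of the two matrices \<open>Q\<close> in \<open>S4\<close>.

  The local error is controlled by a defect. The right-hand side of the step equation is \<open>h\<close> times a
  \<open>C\<^sup>1\<close> map, so for small \<open>h\<close> the step is the fixed point of a contraction with constant \<open>1/2\<close>, and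
  its distance to the exact solution is at most twice the residual of the exact solution in the step
  equation (\<open>implicit_step\<close>). It remains to show that this residual is \<open>O(h\<^sup>5)\<close>
  (\<open>exact_solution_defect\<close>), for which two expansions about the midpoint are compared.

  The first holds for every autonomous equation (\<open>solution_midpoint_expansion\<close>):
  the exact solution satisfies
  \<open>v = h F(m) + h/24 F''(m)(v, v) - h\<^sup>3/12 F'(m) F'(m) F(m) + O(h\<^sup>5)\<close>.

  The second holds for every smooth symmetric discrete gradient
  (\<open>corrected_discrete_gradient_expansion\<close>):
  \<open>DG(x, z) + 1/2 \<Delta> v = grad H(m) + 1/24 (grad H)''(m)(v, v) + O(|v|\<^sup>4)\<close>.
  Thus \<open>\<Delta>\<close> turns an arbitrary symmetric discrete gradient, up to fourth order, into the mean value of the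
  gradient over the chord. The reason is that differentiating the defining equation of a discrete
  gradient yields \<open>D2 DG(x, z)\<^sup>T (z - x) = grad H(z) - DG(x, z)\<close> (\<open>D2_transpose_mult\<close>), so \<open>\<Delta> v\<close> is a
  combination of values and directional derivatives of \<open>DG\<close> at pairs of points of the line through \<open>x\<close>
  and \<open>z\<close>. The combination is invariant under reflection in the midpoint, so only even orders occur,
  and at second order it is a matter of linear algebra with two vectors.

  Since \<open>h S DG(x, z) = v + O(h\<^sup>3)\<close>, the \<open>Q\<close>-term of the method acts as \<open>1/2 S \<Delta> v\<close>; and the Hessian
  term acts as \<open>- h\<^sup>2/12 F' F' F\<close>, because \<open>F' = S \<nabla>\<^sup>2H\<close>. Hence the two expansions coincide.

  Skew-symmetry of \<open>S4\<close> rests on the symmetry of the Hessian, which the same identity for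
  \<open>D2 DG\<close> provides (\<open>hessian_symmetric\<close>).
\<close>

section \<open>Closure properties of \<open>C\<^sup>k\<close> maps\<close>

lemma C_k_has_derivative:
  "C_k (Suc k) f \<Longrightarrow> (f has_derivative frechet_derivative f (at x)) (at x)"
  by (simp add: frechet_derivative_works[symmetric])

abbreviation ddir :: "'a::euclidean_space \<Rightarrow> ('a \<Rightarrow> 'b::real_normed_vector) \<Rightarrow> 'a \<Rightarrow> 'b" where
  "ddir v f \<equiv> (\<lambda>x. frechet_derivative f (at x) v)"

lemma C_k_ddir: "C_k (Suc k) f \<Longrightarrow> C_k k (ddir v f)"
  by simp

lemma C_k_SucI:
  assumes "\<And>x. (f has_derivative f' x) (at x)" and "\<And>v. C_k k (\<lambda>x. f' x v)"
  shows "C_k (Suc k) f"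
proof -
  have "f' x = frechet_derivative f (at x)" for x
    using assms(1) frechet_derivative_at by blast
  with assms show ?thesis
    by (auto simp: differentiable_def)
qed

lemma C_k_SucD: "C_k (Suc k) f \<Longrightarrow> C_k k f"
proof (induction k arbitrary: f)
  case 0
  then have "f differentiable (at x)" for x by simp
  then show ?case
    by (simp add: continuous_at_imp_continuous_on differentiable_imp_continuous_within)
next
  case (Suc k)
  then show ?case by (metis C_k.simps(2))
qed

lemma C_k_mono: "C_k k f \<Longrightarrow> j \<le> k \<Longrightarrow> C_k j f"
proof (induction k)
  case (Suc k)
  then show ?case using C_k_SucD le_Suc_eq by blast
qed simp

lemma C_k_continuous_on: "C_k k f \<Longrightarrow> continuous_on A f"
  by (metis C_k.simps(1) C_k_mono continuous_on_subset le0 subset_UNIV)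

lemma C_k_const: "C_k k (\<lambda>x. c)"
  by (induction k arbitrary: c) auto

lemma C_k_bounded_linear: "bounded_linear L \<Longrightarrow> C_k k L"
proof (cases k)
  case (Suc j)
  assume L: "bounded_linear L"
  have "C_k (Suc j) L"
    by (rule C_k_SucI[OF bounded_linear_imp_has_derivative[OF L] C_k_const])
  with Suc show ?thesis by simp
qed (simp add: linear_continuous_on)

lemma C_k_add: "C_k k f \<Longrightarrow> C_k k g \<Longrightarrow> C_k k (\<lambda>x. f x + g x)"
proof (induction k arbitrary: f g)
  case 0
  then show ?case by (auto intro: continuous_intros)
next
  case (Suc k)
  then show ?case
    by (intro C_k_SucI[OF has_derivative_add[OF C_k_has_derivative C_k_has_derivative]] Suc.IH) auto
qed

lemma C_k_sum: "(\<And>i. i \<in> I \<Longrightarrow> C_k k (f i)) \<Longrightarrow> C_k k (\<lambda>x. \<Sum>i\<in>I. f i x)"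
  by (induction I rule: infinite_finite_induct) (simp_all del: C_k.simps add: C_k_const C_k_add)

lemma C_k_linear_image:
  assumes "bounded_linear L" shows "C_k k f \<Longrightarrow> C_k k (\<lambda>x. L (f x))"
proof (induction k arbitrary: f)
  case 0
  then show ?case by (auto intro: bounded_linear.continuous_on[OF assms])
next
  case (Suc k)
  then show ?case
    by (intro C_k_SucI[OF bounded_linear.has_derivative[OF assms C_k_has_derivative]] Suc.IH) auto
qed

lemma C_k_bilinear:
  assumes "bounded_bilinear B"
  shows "C_k k f \<Longrightarrow> C_k k g \<Longrightarrow> C_k k (\<lambda>x. B (f x) (g x))"
proof (induction k arbitrary: f g)
  case 0
  then show ?case by (auto intro: bounded_bilinear.continuous_on[OF assms])
next
  case (Suc k)
  note prems = Suc.prems Suc.prems[THEN C_k_SucD] Suc.prems[THEN C_k_ddir]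
  show ?case
    by (rule C_k_SucI[OF bounded_bilinear.FDERIV[OF assms C_k_has_derivative C_k_has_derivative]])
      (rule prems C_k_add Suc.IH)+
qed

lemma C_k_affine:
  assumes L: "bounded_linear L" shows "C_k k f \<Longrightarrow> C_k k (\<lambda>x. f (c + L x))"
proof (induction k arbitrary: f)
  case 0
  then show ?case
    by (auto intro!: continuous_intros continuous_on_compose2[of UNIV f] linear_continuous_on[OF L])
next
  case (Suc k)
  have "((\<lambda>x. f (c + L x)) has_derivative (\<lambda>v. frechet_derivative f (at (c + L x)) (L v))) (at x)" for x
    by (rule has_derivative_compose[OF _ C_k_has_derivative[OF Suc.prems], where f = "\<lambda>x. c + L x"])
      (auto intro!: derivative_eq_intros bounded_linear_imp_has_derivative[OF L])
  then show ?case
    by (rule C_k_SucI) (use Suc in auto)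
qed

lemma C_k_linear_compose: "bounded_linear L \<Longrightarrow> C_k k f \<Longrightarrow> C_k k (\<lambda>x. f (L x))"
  using C_k_affine[of L k f 0] by simp

lemma C_k_diff: "C_k k f \<Longrightarrow> C_k k g \<Longrightarrow> C_k k (\<lambda>x. f x - g x)"
  using C_k_add[OF _ C_k_linear_image[OF bounded_linear_minus[OF bounded_linear_ident]], of k f g]
  by simp

lemma C_k_scaleR: "C_k k f \<Longrightarrow> C_k k (\<lambda>x. c *\<^sub>R f x)"
  by (rule C_k_linear_image[OF bounded_linear_scaleR_right])

lemma C_k_componentwise:
  fixes f :: "'a::euclidean_space \<Rightarrow> 'b::euclidean_space"
  assumes "\<And>b. b \<in> Basis \<Longrightarrow> C_k k (\<lambda>x. f x \<bullet> b)"
  shows "C_k k f"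
proof -
  have "C_k k (\<lambda>x. \<Sum>b\<in>Basis. (f x \<bullet> b) *\<^sub>R b)"
    by (intro C_k_sum C_k_linear_image[OF bounded_linear_scaleR_left] assms)
  then show ?thesis by (simp add: euclidean_representation)
qed

section \<open>Iterated directional derivatives and Taylor's formula\<close>

lemma ddir_basis:
  assumes "C_k (Suc k) f"
  shows "frechet_derivative f (at x) v = (\<Sum>b\<in>Basis. (v \<bullet> b) *\<^sub>R frechet_derivative f (at x) b)"
proof -
  have lin: "linear (frechet_derivative f (at x))"
    using assms by (simp add: linear_frechet_derivative)
  have "frechet_derivative f (at x) v = frechet_derivative f (at x) (\<Sum>b\<in>Basis. (v \<bullet> b) *\<^sub>R b)"
    by (simp add: euclidean_representation)
  also have "\<dots> = (\<Sum>b\<in>Basis. (v \<bullet> b) *\<^sub>R frechet_derivative f (at x) b)"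
    by (simp add: linear_sum[OF lin] linear_cmul[OF lin])
  finally show ?thesis .
qed

lemma C_k_ddir_along:
  assumes "C_k (Suc k) f" "C_k k g"
  shows "C_k k (\<lambda>x. frechet_derivative f (at x) (g x))"
proof -
  have "C_k k (\<lambda>x. \<Sum>b\<in>Basis. (g x \<bullet> b) *\<^sub>R frechet_derivative f (at x) b)"
    using assms
    by (intro C_k_sum C_k_bilinear[OF bounded_bilinear_scaleR]
        C_k_linear_image[OF bounded_linear_inner_left]) auto
  then show ?thesis by (simp add: ddir_basis[OF assms(1), symmetric])
qed

lemma ddir_linear_combination:
  assumes "\<And>i. i \<in> I \<Longrightarrow> C_k (Suc k) (f i)"
  shows "ddir v (\<lambda>x. \<Sum>i\<in>I. c i *\<^sub>R f i x) = (\<lambda>x. \<Sum>i\<in>I. c i *\<^sub>R ddir v (f i) x)"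
proof
  fix x
  have "((\<lambda>x. \<Sum>i\<in>I. c i *\<^sub>R f i x) has_derivative
      (\<lambda>v. \<Sum>i\<in>I. c i *\<^sub>R frechet_derivative (f i) (at x) v)) (at x)"
    by (intro has_derivative_sum has_derivative_scaleR_right C_k_has_derivative[OF assms])
  from fun_cong[OF frechet_derivative_at[OF this], of v]
  show "ddir v (\<lambda>x. \<Sum>i\<in>I. c i *\<^sub>R f i x) x = (\<Sum>i\<in>I. c i *\<^sub>R ddir v (f i) x)"
    by (rule sym)
qed

text \<open>Directions are consumed from the head, each by differentiating the function, because this is how
  \<open>C_k\<close> unfolds. Along a line all directions agree, and \<open>iterdir (replicate i u) f p\<close> is the
  \<open>i\<close>-th derivative of \<open>\<lambda>s. f (p + s u)\<close> at \<open>0\<close>.\<close>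

primrec iterdir :: "'a::euclidean_space list \<Rightarrow> ('a \<Rightarrow> 'b::real_normed_vector) \<Rightarrow> 'a \<Rightarrow> 'b" where
  "iterdir [] f = f"
| "iterdir (u # us) f = iterdir us (ddir u f)"

lemma iterdir_snoc: "iterdir (us @ [w]) f = ddir w (iterdir us f)"
  by (induction us arbitrary: f) auto

lemma C_k_iterdir: "C_k (length us + k) f \<Longrightarrow> C_k k (iterdir us f)"
  by (induction us arbitrary: f) auto

lemma iterdir_linear_combination:
  assumes "\<And>i. i \<in> I \<Longrightarrow> C_k (length us) (f i)"
  shows "iterdir us (\<lambda>x. \<Sum>i\<in>I. c i *\<^sub>R f i x) = (\<lambda>x. \<Sum>i\<in>I. c i *\<^sub>R iterdir us (f i) x)"
  using assms
proof (induction us arbitrary: f)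
  case (Cons u us)
  have "ddir u (\<lambda>x. \<Sum>i\<in>I. c i *\<^sub>R f i x) = (\<lambda>x. \<Sum>i\<in>I. c i *\<^sub>R ddir u (f i) x)"
    by (rule ddir_linear_combination[where k = "length us"]) (use Cons.prems in simp)
  moreover have "iterdir us (\<lambda>x. \<Sum>i\<in>I. c i *\<^sub>R ddir u (f i) x)
      = (\<lambda>x. \<Sum>i\<in>I. c i *\<^sub>R iterdir us (ddir u (f i)) x)"
    by (rule Cons.IH) (use Cons.prems in simp)
  ultimately show ?case by simp
qed simp

text \<open>Expanding the first direction in the basis reduces the bound for \<open>f\<close> to bounds for its finitely
  many partial derivatives. What matters is the dependence on the directions: the remainders below have
  to be uniform in the chord \<open>z - x\<close> and of the right power in its length.\<close>

lemma iterdir_bound: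
  fixes f :: "'a::euclidean_space \<Rightarrow> 'b::real_normed_vector"
  assumes K: "compact K"
  shows "C_k k f \<Longrightarrow> \<exists>M\<ge>0. \<forall>us. length us = k \<longrightarrow>
    (\<forall>x\<in>K. norm (iterdir us f x) \<le> M * prod_list (map norm us))"
proof (induction k arbitrary: f)
  case 0
  then have "bounded (f ` K)"
    by (intro compact_imp_bounded compact_continuous_image[OF _ K] C_k_continuous_on)
  then obtain M where "M > 0" "\<forall>x\<in>K. norm (f x) \<le> M"
    by (auto simp: bounded_pos)
  then show ?case by (intro exI[of _ M]) auto
next
  case (Suc k)
  have "\<exists>M\<ge>0. \<forall>us. length us = k \<longrightarrow>
    (\<forall>x\<in>K. norm (iterdir us (ddir b f) x) \<le> M * prod_list (map norm us))" for b
    by (rule Suc.IH) (use Suc.prems in simp)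
  then obtain M where M0: "\<And>b. M b \<ge> 0" and M: "\<And>b us x. length us = k \<Longrightarrow> x \<in> K \<Longrightarrow>
      norm (iterdir us (ddir b f) x) \<le> M b * prod_list (map norm us)"
    by metis
  have "norm (iterdir us f x) \<le> (\<Sum>b\<in>Basis. M b) * prod_list (map norm us)"
    if len: "length us = Suc k" and x: "x \<in> K" for us x
  proof -
    obtain w ws where us: "us = w # ws" and ws: "length ws = k"
      using len by (cases us) auto
    have "ddir w f = (\<lambda>x. \<Sum>b\<in>Basis. (w \<bullet> b) *\<^sub>R ddir b f x)"
      using ddir_basis[OF Suc.prems] by blast
    then have "iterdir us f x = (\<Sum>b\<in>Basis. (w \<bullet> b) *\<^sub>R iterdir ws (ddir b f) x)"
      using iterdir_linear_combination[of Basis ws "\<lambda>b. ddir b f" "\<lambda>b. w \<bullet> b"] Suc.prems ws us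
      by simp
    also have "norm \<dots> \<le> (\<Sum>b\<in>Basis. norm w * (M b * prod_list (map norm ws)))"
      by (intro sum_norm_le) (auto intro!: mult_mono Basis_le_norm M ws x)
    also have "\<dots> = (\<Sum>b\<in>Basis. M b) * prod_list (map norm us)"
      by (simp add: us sum_distrib_right sum_distrib_left mult_ac)
    finally show ?thesis .
  qed
  then show ?case
    by (intro exI[of _ "\<Sum>b\<in>Basis. M b"]) (simp add: M0 sum_nonneg)
qed

lemma C_1_Lipschitz_on_compact:
  fixes f :: "'a::euclidean_space \<Rightarrow> 'b::real_normed_vector"
  assumes "C_k 1 f" "compact K" "convex K"
  shows "\<exists>L\<ge>0. \<forall>x\<in>K. \<forall>y\<in>K. norm (f x - f y) \<le> L * norm (x - y)"
proof -
  obtain M where M0: "M \<ge> 0" and M: "\<And>us x. length us = 1 \<Longrightarrow> x \<in> K \<Longrightarrow>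
      norm (iterdir us f x) \<le> M * prod_list (map norm us)"
    using iterdir_bound[OF assms(2,1)] by blast
  have der: "(f has_derivative frechet_derivative f (at x)) (at x within K)" for x
    by (rule has_derivative_at_withinI, rule C_k_has_derivative[where k = 0]) (use assms in simp)
  have "onorm (frechet_derivative f (at x)) \<le> M" if "x \<in> K" for x
    using M[of "[_]" x] that by (intro onorm_le) auto
  then show ?thesis
    using differentiable_bound[OF assms(3) der, of M] M0 by blast
qed

text \<open>The remainder of order \<open>n + 1\<close> of \<open>g 0\<close> vanishes at \<open>0\<close>, and its derivative is the
  remainder of order \<open>n\<close> of \<open>g 1\<close>; the mean value inequality on the unit interval carries the bound
  over without loss. This covers vector values, and both the lines used for discrete gradients and the
  solution curve, which need not extend to a \<open>C\<^sup>k\<close> map on all of \<open>\<real>\<close>.\<close>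

lemma taylor_unit_interval:
  fixes g :: "nat \<Rightarrow> real \<Rightarrow> 'b::real_normed_vector"
  assumes "\<And>i s. i < n \<Longrightarrow> s \<in> {0..1} \<Longrightarrow> (g i has_vector_derivative g (Suc i) s) (at s within {0..1})"
    and "\<And>s. s \<in> {0..1} \<Longrightarrow> norm (g n s) \<le> M" and "s \<in> {0..1}"
  shows "norm (g 0 s - (\<Sum>i<n. (s ^ i / fact i) *\<^sub>R g i 0)) \<le> M"
  using assms
proof (induction n arbitrary: g s)
  case (Suc n)
  define r where "r s = g 0 s - (\<Sum>i<Suc n. (s ^ i / fact i) *\<^sub>R g i 0)" for s
  define r' where "r' s = g 1 s - (\<Sum>i<n. (s ^ i / fact i) *\<^sub>R g (Suc i) 0)" for s
  have bound: "norm (r' s) \<le> M" if "s \<in> {0..1}" for s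
    using Suc.IH[of "\<lambda>i. g (Suc i)" s] Suc.prems that unfolding r'_def by simp
  have r_alt: "r = (\<lambda>s. g 0 s - (g 0 0 + (\<Sum>i<n. (s ^ Suc i / fact (Suc i)) *\<^sub>R g (Suc i) 0)))"
    by (rule ext) (simp only: r_def sum.lessThan_Suc_shift, simp)
  have der: "(r has_derivative (\<lambda>t. t *\<^sub>R r' s)) (at s within {0..1})" if s: "s \<in> {0..1}" for s
  proof -
    have "((\<lambda>s. s ^ Suc i / fact (Suc i)) has_real_derivative s ^ i / fact i) (at s within {0..1})" for i
      by (rule derivative_eq_intros refl | simp del: of_nat_Suc)+
    then have "((\<lambda>s. (s ^ Suc i / fact (Suc i)) *\<^sub>R g (Suc i) 0) has_vector_derivative
        (s ^ i / fact i) *\<^sub>R g (Suc i) 0) (at s within {0..1})" for i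
      using has_vector_derivative_scaleR[of _ _ _ _ "\<lambda>_. g (Suc i) 0" 0] by force
    then have "((\<lambda>s. \<Sum>i<n. (s ^ Suc i / fact (Suc i)) *\<^sub>R g (Suc i) 0) has_vector_derivative
        (\<Sum>i<n. (s ^ i / fact i) *\<^sub>R g (Suc i) 0)) (at s within {0..1})"
      by (intro has_vector_derivative_sum)
    from has_vector_derivative_diff[OF Suc.prems(1)[of 0 s]
        has_vector_derivative_add[OF has_vector_derivative_const this]]
    have "(r has_vector_derivative r' s) (at s within {0..1})"
      using s unfolding r_alt r'_def by simp
    then show ?thesis by (simp add: has_vector_derivative_def)
  qed
  have "norm (r s - r 0) \<le> M * norm (s - 0)"
  proof (rule differentiable_bound[OF _ der])
    show "onorm (\<lambda>t. t *\<^sub>R r' x) \<le> M" if "x \<in> {0..1}" for x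
      using mult_right_mono[OF bound[OF that] abs_ge_zero]
      by (intro onorm_le) (simp add: mult.commute)
  qed (use Suc.prems in auto)
  moreover have "r 0 = 0"
    unfolding r_alt by simp
  moreover have "M \<ge> 0"
    using Suc.prems(2)[of s] Suc.prems(3) norm_ge_zero order_trans by blast
  ultimately have "norm (r s) \<le> M"
    using Suc.prems(3) mult_left_le[of "\<bar>s\<bar>" M] by auto
  then show ?case by (simp add: r_def)
qed simp

lemma taylor_directional:
  fixes f :: "'a::euclidean_space \<Rightarrow> 'b::real_normed_vector"
  assumes f: "C_k n f"
    and bound: "\<And>s. s \<in> {0..1} \<Longrightarrow> norm (iterdir (replicate n u) f (p + s *\<^sub>R u)) \<le> M"
  shows "norm (f (p + u) - (\<Sum>i<n. (1 / fact i) *\<^sub>R iterdir (replicate i u) f p)) \<le> M"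
proof -
  define g where "g i s = iterdir (replicate i u) f (p + s *\<^sub>R u)" for i s
  have "(g i has_vector_derivative g (Suc i) s) (at s within {0..1})" if i: "i < n" for i s
  proof -
    obtain k where k: "n = i + Suc k" using i less_iff_Suc_add by auto
    have C: "C_k (Suc k) (iterdir (replicate i u) f)"
      using f unfolding k by (intro C_k_iterdir) simp
    have lin: "linear (frechet_derivative (iterdir (replicate i u) f) (at y))" for y
      using C by (simp add: linear_frechet_derivative)
    have "(g i has_derivative (\<lambda>t. frechet_derivative (iterdir (replicate i u) f)
        (at (p + s *\<^sub>R u)) (t *\<^sub>R u))) (at s within {0..1})"
      unfolding g_def
      by (rule has_derivative_compose[OF _ C_k_has_derivative[OF C], where f = "\<lambda>s. p + s *\<^sub>R u"])
        (auto intro!: derivative_eq_intros)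
    moreover have "g (Suc i) s
        = frechet_derivative (iterdir (replicate i u) f) (at (p + s *\<^sub>R u)) u"
      unfolding g_def replicate_Suc replicate_append_same[symmetric] by (simp only: iterdir_snoc)
    ultimately show ?thesis
      by (simp add: has_vector_derivative_def linear_cmul[OF lin])
  qed
  from taylor_unit_interval[of n g M 1, OF this] bound show ?thesis
    by (simp add: g_def)
qed

lemma ddir_scale: "C_k (Suc k) f \<Longrightarrow> ddir (c *\<^sub>R v) f = (\<lambda>x. c *\<^sub>R ddir v f x)"
  by (simp add: linear_cmul linear_frechet_derivative)

lemma iterdir_map_scaleR:
  "C_k (length us) f \<Longrightarrow>
    iterdir (map ((*\<^sub>R) c) us) f = (\<lambda>x. c ^ length us *\<^sub>R iterdir us f x)"
proof (induction us arbitrary: f)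
  case (Cons u us)
  have C: "C_k (length us) (ddir u f)" using Cons.prems by simp
  have C': "C_k (length (map ((*\<^sub>R) c) us)) (ddir u f)" using C by simp
  have "iterdir (map ((*\<^sub>R) c) (u # us)) f = iterdir (map ((*\<^sub>R) c) us) (\<lambda>x. c *\<^sub>R ddir u f x)"
    using ddir_scale[of "length us" f c u] Cons.prems by simp
  also have "\<dots> = (\<lambda>x. c *\<^sub>R iterdir (map ((*\<^sub>R) c) us) (ddir u f) x)"
    using iterdir_linear_combination[of "{()}" "map ((*\<^sub>R) c) us" "\<lambda>_. ddir u f" "\<lambda>_. c"] C'
    by simp
  finally show ?case
    using Cons.IH[OF C] by simp
qed simp

text \<open>Linearity in the outer direction is linearity of the derivative; in the inner direction it
  comes from differentiating the basis expansion of \<open>ddir w f\<close>.\<close>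

lemma bilinear_second_derivative:
  assumes f: "C_k 2 f"
  shows "bilinear (\<lambda>u w. ddir u (ddir w f) x)"
  unfolding bilinear_def
proof (intro conjI allI)
  have C: "C_k (Suc 1) f" "C_k (Suc 0) (ddir w f)" for w
    using f by (simp_all add: numeral_2_eq_2)
  show "linear (\<lambda>u. ddir u (ddir w f) x)" for w
    by (rule linear_frechet_derivative) (use C(2)[of w] in simp)
  show "linear (\<lambda>w. ddir u (ddir w f) x)" for u
  proof -
    have "ddir w f = (\<lambda>x. \<Sum>b\<in>Basis. (w \<bullet> b) *\<^sub>R ddir b f x)" for w
      using ddir_basis[OF C(1)] by blast
    then have "ddir u (ddir w f) x = ddir u (\<lambda>x. \<Sum>b\<in>Basis. (w \<bullet> b) *\<^sub>R ddir b f x) x" for w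
      by (rule arg_cong[where f = "\<lambda>g. frechet_derivative g (at x) u"])
    also have "\<dots> w = (\<Sum>b\<in>Basis. (w \<bullet> b) *\<^sub>R ddir u (ddir b f) x)" for w
      by (rule fun_cong[OF ddir_linear_combination], rule C(2))
    finally have eq: "ddir u (ddir w f) x = (\<Sum>b\<in>Basis. (w \<bullet> b) *\<^sub>R ddir u (ddir b f) x)" for w .
    define c where "c b = ddir u (ddir b f) x" for b
    have "linear (\<lambda>w. \<Sum>b\<in>Basis. (w \<bullet> b) *\<^sub>R c b)"
      by (auto intro!: linearI
          simp: inner_add_left scaleR_add_left sum.distrib scaleR_right.sum)
    then show ?thesis
      by (subst eq) (simp only: c_def)
  qed
qed

lemma ddir_linear_compose:
  assumes L: "bounded_linear L" and f: "C_k (Suc k) f"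
  shows "ddir v (\<lambda>x. f (L x)) = (\<lambda>x. ddir (L v) f (L x))"
proof
  fix x
  have "((\<lambda>x. f (L x)) has_derivative (\<lambda>v. ddir (L v) f (L x))) (at x)"
    by (rule has_derivative_compose[OF bounded_linear_imp_has_derivative[OF L]
          C_k_has_derivative[OF f]])
  from fun_cong[OF frechet_derivative_at[OF this], of v]
  show "ddir v (\<lambda>x. f (L x)) x = ddir (L v) f (L x)"
    by (rule sym)
qed

lemma second_derivative_linear_compose:
  assumes L: "bounded_linear L" and f: "C_k 2 f"
  shows "ddir u (ddir w (\<lambda>x. f (L x))) x = ddir (L u) (ddir (L w) f) (L x)"
proof -
  have C: "C_k (Suc 1) f" "C_k (Suc 0) (ddir (L w) f)"
    using f by (simp_all add: numeral_2_eq_2)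
  show ?thesis
    unfolding ddir_linear_compose[OF L C(1)] by (rule fun_cong[OF ddir_linear_compose[OF L C(2)]])
qed

lemma ddir_linear_image:
  assumes L: "bounded_linear L" and f: "C_k (Suc k) f"
  shows "ddir v (\<lambda>x. L (f x)) = (\<lambda>x. L (ddir v f x))"
proof
  fix x
  have "((\<lambda>x. L (f x)) has_derivative (\<lambda>v. L (ddir v f x))) (at x)"
    by (rule bounded_linear.has_derivative[OF L C_k_has_derivative[OF f]])
  from fun_cong[OF frechet_derivative_at[OF this], of v]
  show "ddir v (\<lambda>x. L (f x)) x = L (ddir v f x)"
    by (rule sym)
qed

section \<open>Central differences\<close>

lemma convex_segment_point:
  assumes "convex K" "p \<in> K" "p + u \<in> K" "s \<in> {0..1}"
  shows "p + s *\<^sub>R u \<in> K"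
proof -
  have "(1 - s) *\<^sub>R p + s *\<^sub>R (p + u) \<in> K"
    using assms by (intro convexD) auto
  then show ?thesis by (simp add: algebra_simps)
qed

lemma taylor_compact_convex:
  fixes f :: "'a::euclidean_space \<Rightarrow> 'b::real_normed_vector"
  assumes f: "C_k n f" and K: "compact K" "convex K"
  shows "\<exists>M\<ge>0. \<forall>p u. p \<in> K \<longrightarrow> p + u \<in> K \<longrightarrow>
    norm (f (p + u) - (\<Sum>i<n. (1 / fact i) *\<^sub>R iterdir (replicate i u) f p)) \<le> M * norm u ^ n"
proof -
  obtain M where M0: "M \<ge> 0" and M: "\<And>us x. length us = n \<Longrightarrow> x \<in> K \<Longrightarrow>
      norm (iterdir us f x) \<le> M * prod_list (map norm us)"
    using iterdir_bound[OF K(1) f] by blast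
  show ?thesis
    using M0 M[of "replicate n _"] convex_segment_point[OF K(2)]
    by (intro exI[of _ M]) (auto intro!: taylor_directional f)
qed

text \<open>Adding the Taylor expansions at \<open>p + u\<close> and \<open>p - u\<close> cancels the odd terms, which leaves a
  fourth order remainder after the second derivative.\<close>

lemma central_second_difference:
  fixes f :: "'a::euclidean_space \<Rightarrow> 'b::real_normed_vector"
  assumes f: "C_k 4 f" and K: "compact K" "convex K"
  shows "\<exists>M\<ge>0. \<forall>p u. p \<in> K \<longrightarrow> p + u \<in> K \<longrightarrow> p - u \<in> K \<longrightarrow>
    norm (f (p + u) + f (p - u) - 2 *\<^sub>R f p - ddir u (ddir u f) p) \<le> M * norm u ^ 4"
proof -
  let ?T = "\<lambda>u p. \<Sum>i<4. (1 / fact i) *\<^sub>R iterdir (replicate i u) f p"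
  obtain M where M0: "M \<ge> 0" and M: "\<And>p u. p \<in> K \<Longrightarrow> p + u \<in> K \<Longrightarrow>
      norm (f (p + u) - ?T u p) \<le> M * norm u ^ 4"
    using taylor_compact_convex[OF f K] by blast
  have parity: "iterdir (replicate i (- u)) f p = (- 1) ^ i *\<^sub>R iterdir (replicate i u) f p" if "i < 4" for i u p
    using iterdir_map_scaleR[of "replicate i u" f "-1"] C_k_mono[OF f, of i] that
    by (simp add: map_replicate)
  have T: "?T u p + ?T (- u) p = 2 *\<^sub>R f p + ddir u (ddir u f) p" for u p
  proof -
    have "?T (- u) p = (\<Sum>i<4. (1 / fact i) *\<^sub>R ((- 1) ^ i *\<^sub>R iterdir (replicate i u) f p))"
      by (intro sum.cong refl) (simp add: parity)
    then show ?thesis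
      by (simp add: eval_nat_numeral scaleR_2[unfolded eval_nat_numeral] flip: scaleR_left.add)
  qed
  have "norm (f (p + u) + f (p - u) - 2 *\<^sub>R f p - ddir u (ddir u f) p) \<le> (2 * M) * norm u ^ 4"
    if "p \<in> K" "p + u \<in> K" "p - u \<in> K" for p u
  proof -
    have "f (p + u) + f (p - u) - 2 *\<^sub>R f p - ddir u (ddir u f) p
        = (f (p + u) - ?T u p) + (f (p + - u) - ?T (- u) p)"
      using T[of u p] by (simp add: algebra_simps)
    also have "norm \<dots> \<le> M * norm u ^ 4 + M * norm (- u) ^ 4"
      by (intro norm_triangle_le add_mono M) (use that in auto)
    finally show ?thesis by simp
  qed
  then show ?thesis
    using M0 by (intro exI[of _ "2 * M"]) auto
qed

text \<open>Here the even terms cancel. The direction \<open>w\<close> enters the bound linearly, so that for \<open>w\<close> and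
  \<open>u\<close> both of the size of the chord the remainder is of fourth order as well.\<close>

lemma central_difference_of_derivative:
  fixes f :: "'a::euclidean_space \<Rightarrow> 'b::real_normed_vector"
  assumes f: "C_k 4 f" and K: "compact K" "convex K"
  shows "\<exists>M\<ge>0. \<forall>p u w. p \<in> K \<longrightarrow> p + u \<in> K \<longrightarrow> p - u \<in> K \<longrightarrow>
    norm (ddir w f (p + u) - ddir w f (p - u) - 2 *\<^sub>R ddir u (ddir w f) p) \<le> M * norm w * norm u ^ 3"
proof -
  have f': "C_k 3 (ddir w f)" for w
    using f by (intro C_k_ddir) (simp del: C_k.simps)
  let ?T = "\<lambda>w u p. \<Sum>i<3. (1 / fact i) *\<^sub>R iterdir (replicate i u) (ddir w f) p"
  obtain M where M0: "M \<ge> 0" and M: "\<And>us x. length us = 4 \<Longrightarrow> x \<in> K \<Longrightarrow>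
      norm (iterdir us f x) \<le> M * prod_list (map norm us)"
    using iterdir_bound[OF K(1) f] by blast
  have R: "norm (ddir w f (p + u) - ?T w u p) \<le> M * norm w * norm u ^ 3"
    if "p \<in> K" "p + u \<in> K" for w u p
    by (rule taylor_directional[OF f'])
      (use M[of "w # replicate 3 u"] convex_segment_point[OF K(2)] that in \<open>simp add: mult_ac\<close>)
  have parity: "iterdir (replicate i (- u)) (ddir w f) p = (- 1) ^ i *\<^sub>R iterdir (replicate i u) (ddir w f) p"
    if "i < 3" for i u w p
    using iterdir_map_scaleR[of "replicate i u" "ddir w f" "-1"] C_k_mono[OF f', of i] that
    by (simp add: map_replicate)
  have T: "?T w u p - ?T w (- u) p = 2 *\<^sub>R ddir u (ddir w f) p" for w u p
  proof -
    have "?T w (- u) p = (\<Sum>i<3. (1 / fact i) *\<^sub>R ((- 1) ^ i *\<^sub>R iterdir (replicate i u) (ddir w f) p))"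
      by (intro sum.cong refl) (simp add: parity)
    then show ?thesis
      by (simp add: eval_nat_numeral scaleR_2[unfolded eval_nat_numeral] flip: scaleR_left.add)
  qed
  have "norm (ddir w f (p + u) - ddir w f (p - u) - 2 *\<^sub>R ddir u (ddir w f) p)
      \<le> (2 * M) * norm w * norm u ^ 3"
    if "p \<in> K" "p + u \<in> K" "p - u \<in> K" for p u w
  proof -
    have "ddir w f (p + u) - ddir w f (p - u) - 2 *\<^sub>R ddir u (ddir w f) p
        = (ddir w f (p + u) - ?T w u p) - (ddir w f (p + - u) - ?T w (- u) p)"
      using T[where w = w and u = u and p = p] by (simp add: algebra_simps)
    also have "norm \<dots> \<le> M * norm w * norm u ^ 3 + M * norm w * norm (- u) ^ 3"
      by (intro order_trans[OF norm_triangle_ineq4] add_mono R) (use that in auto)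
    finally show ?thesis by simp
  qed
  then show ?thesis
    using M0 by (intro exI[of _ "2 * M"]) auto
qed

section \<open>Symmetric discrete gradients along a line\<close>

text \<open>The gradient is a definite description, so existence has to be supplied: it is the vector that
  represents the derivative.\<close>

lemma has_gradient_grad:
  fixes H :: "'a::euclidean_space \<Rightarrow> real"
  assumes "H differentiable (at x)"
  shows "GDERIV H x :> grad H x"
proof -
  have lin: "linear (frechet_derivative H (at x))"
    using assms by (rule linear_frechet_derivative)
  define D where "D = (\<Sum>b\<in>Basis. frechet_derivative H (at x) b *\<^sub>R b)"
  have "frechet_derivative H (at x) u = u \<bullet> D" for u
  proof -
    have "frechet_derivative H (at x) u = frechet_derivative H (at x) (\<Sum>b\<in>Basis. (u \<bullet> b) *\<^sub>R b)"
      by (simp add: euclidean_representation)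
    also have "\<dots> = u \<bullet> D"
      by (simp add: D_def inner_sum_right linear_sum[OF lin] linear_cmul[OF lin] mult.commute)
    finally show ?thesis .
  qed
  then have "frechet_derivative H (at x) = (\<lambda>u. u \<bullet> D)"
    by (rule ext)
  then have D: "GDERIV H x :> D"
    using assms frechet_derivative_works[of H "at x"] by (simp only: gderiv_def)
  have "D' = D" if "GDERIV H x :> D'" for D'
  proof -
    have "(\<lambda>u. u \<bullet> D') = (\<lambda>u. u \<bullet> D)"
      using that D unfolding gderiv_def by (rule has_derivative_unique)
    from fun_cong[OF this] show ?thesis
      by (rule vector_eq_ldot[THEN iffD1, OF allI])
  qed
  with D show ?thesis
    unfolding grad_def by (rule theI[where P = "\<lambda>D. GDERIV H x :> D"])
qed

lemma bounded_linear_Pair_0_left: "bounded_linear (\<lambda>u::'b::real_normed_vector. (0::'a::real_normed_vector, u))"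
  by (intro bounded_linear_Pair bounded_linear_zero bounded_linear_ident)

lemma bounded_linear_diagonal: "bounded_linear (\<lambda>u::'a::real_normed_vector. (u, u))"
  by (intro bounded_linear_Pair bounded_linear_ident)

lemma bounded_linear_swap: "bounded_linear (\<lambda>p::'a::real_normed_vector \<times> 'b::real_normed_vector. (snd p, fst p))"
  by (intro bounded_linear_Pair bounded_linear_fst bounded_linear_snd)

lemma bilinear_expand:
  assumes "bilinear q"
  shows "q (\<alpha> *\<^sub>R a + \<beta> *\<^sub>R b) (\<gamma> *\<^sub>R a + \<delta> *\<^sub>R b)
    = (\<alpha> * \<gamma>) *\<^sub>R q a a + (\<alpha> * \<delta>) *\<^sub>R q a b + (\<beta> * \<gamma>) *\<^sub>R q b a + (\<beta> * \<delta>) *\<^sub>R q b b"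
  unfolding bilinear_ladd[OF assms] bilinear_radd[OF assms] bilinear_lmul[OF assms]
    bilinear_rmul[OF assms]
  by (simp add: scaleR_add_right mult.commute add_ac)

lemma inner_transpose_mult: "(transpose A *v x) \<bullet> y = x \<bullet> (A *v y)"
  for A :: "real^'n^'m"
  by (simp add: dot_lmul_matrix transpose_matrix_vector)

lemma jacobian_mult:
  fixes f :: "real^'n \<Rightarrow> real^'m"
  assumes "(f has_derivative f') (at x)"
  shows "jacobian f (at x) *v u = f' u"
proof -
  have "(f has_derivative (\<lambda>u. jacobian f (at x) *v u)) (at x)"
    using assms jacobian_works differentiable_def by blast
  from fun_cong[OF has_derivative_unique[OF this assms], of u] show ?thesis .
qed

locale smooth_symmetric_discrete_gradient =
  fixes H :: "real^'n \<Rightarrow> real" and DG :: "real^'n \<Rightarrow> real^'n \<Rightarrow> real^'n"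
  assumes C_H: "C_k 5 H"
    and C_DG: "C_k 5 (\<lambda>(x, z). DG x z)"
    and dg: "discrete_gradient H DG"
    and symm: "symmetric_dg DG"
begin

abbreviation G :: "(real^'n) \<times> (real^'n) \<Rightarrow> real^'n" where
  "G \<equiv> \<lambda>(x, z). DG x z"

text \<open>The gradient inherits the smoothness of the discrete gradient, being its restriction to the
  diagonal.\<close>

lemma C_grad: "C_k 5 (grad H)"
proof -
  have "C_k 5 (\<lambda>x. G (x, x))"
    by (rule C_k_linear_compose[OF bounded_linear_diagonal C_DG])
  moreover have "(\<lambda>x. G (x, x)) = grad H"
    using dg by (auto simp: discrete_gradient_def)
  ultimately show ?thesis by simp
qed

lemma G_has_derivative: "(G has_derivative frechet_derivative G (at p)) (at p)"
  by (rule C_k_has_derivative[where k = 4]) (use C_DG in \<open>simp del: C_k.simps\<close>)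

lemma DG_has_derivative: "(DG x has_derivative (\<lambda>u. ddir (0, u) G (x, z))) (at z)"
proof -
  have "((\<lambda>z. G ((x, 0) + (0, z))) has_derivative
      (\<lambda>u. ddir (0, u) G ((x, 0) + (0, z)))) (at z)"
    by (rule has_derivative_compose[OF _ G_has_derivative, where f = "\<lambda>z. (x, 0) + (0, z)"])
      (auto intro!: derivative_eq_intros)
  then show ?thesis by simp
qed

lemma D2_mult: "D2 DG x z *v u = ddir (0, u) G (x, z)"
  unfolding D2_def by (rule jacobian_mult[OF DG_has_derivative])

lemma hessian_mult: "hessian H x *v u = ddir u (grad H) x"
  unfolding hessian_def
  by (rule jacobian_mult, rule C_k_has_derivative[where k = 4]) (use C_grad in \<open>simp del: C_k.simps\<close>)

text \<open>This is the derivative of \<open>DG x z \<bullet> (z - x) = H z - H x\<close> with respect to \<open>z\<close>. It removes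
  the transposed Jacobian whenever it meets a multiple of the chord, which is how it occurs in
  \<open>Q_mat\<close>: there only values of the discrete gradient and one directional derivative remain.\<close>

lemma D2_transpose_mult: "transpose (D2 DG x z) *v (z - x) = grad H z - DG x z"
proof -
  have "(transpose (D2 DG x z) *v (z - x)) \<bullet> u = (grad H z - DG x z) \<bullet> u" for u
  proof -
    have H: "(H has_derivative (\<lambda>u. u \<bullet> grad H z)) (at z)"
      using has_gradient_grad[of H z] C_k_mono[OF C_H, of 1] by (simp add: gderiv_def)
    have "((\<lambda>z. DG x z \<bullet> (z - x)) has_derivative
        (\<lambda>u. DG x z \<bullet> u + (D2 DG x z *v u) \<bullet> (z - x))) (at z)"
      by (auto intro!: derivative_eq_intros DG_has_derivative simp: D2_mult)
    moreover have "(\<lambda>z. DG x z \<bullet> (z - x)) = (\<lambda>z. H z - H x)"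
      using dg by (auto simp: discrete_gradient_def)
    ultimately have 1: "((\<lambda>z. H z - H x) has_derivative
        (\<lambda>u. DG x z \<bullet> u + (D2 DG x z *v u) \<bullet> (z - x))) (at z)"
      by simp
    have 2: "((\<lambda>z. H z - H x) has_derivative (\<lambda>u. u \<bullet> grad H z)) (at z)"
      by (auto intro!: derivative_eq_intros H)
    have "DG x z \<bullet> u + (D2 DG x z *v u) \<bullet> (z - x) = u \<bullet> grad H z"
      by (rule fun_cong[OF has_derivative_unique[OF 1 2], of u])
    then show ?thesis
      by (simp only: inner_transpose_mult) (simp add: inner_diff_left inner_diff_right inner_commute algebra_simps)
  qed
  then show ?thesis
    by (rule vector_eq_rdot[THEN iffD1, OF allI])
qed

text \<open>At \<open>z = x + s v\<close> the preceding identity says that \<open>s D2(x, x + s v)\<^sup>T v\<close> equals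
  \<open>grad H (x + s v) - DG x (x + s v)\<close>. Its derivative at \<open>s = 0\<close> is \<open>D2\<^sup>T v = hessian H x v - D2 v\<close>,
  with \<open>D2\<close> taken at \<open>(x, x)\<close>; so the Hessian is the sum of a matrix and its transpose.\<close>

lemma hessian_symmetric: "transpose (hessian H x) = hessian H x"
proof -
  have key: "(hessian H x *v v) \<bullet> w = (D2 DG x x *v v) \<bullet> w + (D2 DG x x *v w) \<bullet> v" for v w
  proof -
    let ?c = "\<lambda>s. ddir (0, w) G (x, x + s *\<^sub>R v) \<bullet> v"
    have eq: "s * ?c s = (grad H (x + s *\<^sub>R v) - DG x (x + s *\<^sub>R v)) \<bullet> w" for s
    proof -
      have "(transpose (D2 DG x (x + s *\<^sub>R v)) *v (s *\<^sub>R v)) \<bullet> w = s * ?c s"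
        by (simp only: inner_transpose_mult) (simp add: D2_mult inner_commute)
      then show ?thesis
        using D2_transpose_mult[of x "x + s *\<^sub>R v"] by simp
    qed
    have "C_k 1 (ddir (0, w) G)"
      by (rule C_k_ddir) (rule C_k_mono[OF C_DG], simp)
    then have "C_k 1 (\<lambda>s. ddir (0, w) G ((x, x) + (0, s *\<^sub>R v)))"
      by (intro C_k_affine bounded_linear_compose[OF bounded_linear_Pair_0_left]
          bounded_linear_scaleR_left)
    then have "(\<lambda>s. ddir (0, w) G (x, x + s *\<^sub>R v)) differentiable (at 0)"
      by simp
    then obtain c' where "((\<lambda>s. ddir (0, w) G (x, x + s *\<^sub>R v)) has_derivative c') (at 0)"
      by (auto simp: differentiable_def)
    then have "((\<lambda>s. s * ?c s) has_derivative (\<lambda>s. s * ?c 0)) (at 0)"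
      by (auto intro!: derivative_eq_intros)
    moreover have "((\<lambda>s. (grad H (x + s *\<^sub>R v) - DG x (x + s *\<^sub>R v)) \<bullet> w) has_derivative
        (\<lambda>s. (ddir (s *\<^sub>R v) (grad H) x - ddir (0, s *\<^sub>R v) G (x, x)) \<bullet> w)) (at 0)"
    proof -
      have line: "((\<lambda>s. x + s *\<^sub>R v) has_derivative (\<lambda>s. s *\<^sub>R v)) (at 0)"
        by (auto intro!: derivative_eq_intros)
      have 1: "((\<lambda>s. grad H (x + s *\<^sub>R v)) has_derivative (\<lambda>s. ddir (s *\<^sub>R v) (grad H) x)) (at 0)"
        using has_derivative_compose[OF line C_k_has_derivative[of 4 "grad H"]] C_grad
        by (simp del: C_k.simps)
      have 2: "((\<lambda>s. DG x (x + s *\<^sub>R v)) has_derivative (\<lambda>s. ddir (0, s *\<^sub>R v) G (x, x))) (at 0)"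
        using has_derivative_compose[OF line DG_has_derivative] by simp
      show ?thesis
        by (intro has_derivative_inner_left has_derivative_diff 1 2)
    qed
    ultimately have "(\<lambda>s. s * ?c 0) = (\<lambda>s. (ddir (s *\<^sub>R v) (grad H) x - ddir (0, s *\<^sub>R v) G (x, x)) \<bullet> w)"
      unfolding eq by (rule has_derivative_unique)
    from fun_cong[OF this, of 1] show ?thesis
      by (simp add: D2_mult hessian_mult inner_diff_left)
  qed
  have "(transpose (hessian H x) *v v) \<bullet> w = (hessian H x *v v) \<bullet> w" for v w
  proof -
    have "(transpose (hessian H x) *v v) \<bullet> w = (hessian H x *v w) \<bullet> v"
      by (metis inner_transpose_mult inner_commute)
    then show ?thesis using key[of v w] key[of w v] by simp
  qed
  then have "transpose (hessian H x) *v v = hessian H x *v v" for v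
    by (rule vector_eq_rdot[THEN iffD1, OF allI])
  then show ?thesis
    by (simp add: matrix_eq)
qed

text \<open>Exchanging the two arguments of \<open>DG\<close> fixes the diagonal and exchanges \<open>(v, 0)\<close> with
  \<open>(0, v)\<close>. Hence the second derivatives of \<open>DG\<close> along a line are governed by two vectors only:
  the pure one and the mixed one.\<close>

lemma second_derivatives_on_diagonal:
  fixes m v :: "real^'n"
  defines "q \<equiv> \<lambda>u w. ddir u (ddir w G) (m, m)"
  shows "q (0, v) (0, v) = q (v, 0) (v, 0)" and "q (0, v) (v, 0) = q (v, 0) (0, v)"
    and "ddir v (ddir v (grad H)) m = q (v, v) (v, v)"
proof -
  have C: "C_k 2 G" by (rule C_k_mono[OF C_DG]) simp
  have swap: "(\<lambda>p. G (snd p, fst p)) = G"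
    using symm by (auto simp: symmetric_dg_def)
  have q_swap: "q u w = q (snd u, fst u) (snd w, fst w)" for u w
    using second_derivative_linear_compose[OF bounded_linear_swap C, where u = u and w = w and x = "(m, m)"]
    unfolding swap by (simp add: q_def)
  show "q (0, v) (0, v) = q (v, 0) (v, 0)" by (subst q_swap) simp
  show "q (0, v) (v, 0) = q (v, 0) (0, v)" by (subst q_swap) simp
  have "(\<lambda>x. G (x, x)) = grad H"
    using dg by (auto simp: discrete_gradient_def)
  then show "ddir v (ddir v (grad H)) m = q (v, v) (v, v)"
    using second_derivative_linear_compose[OF bounded_linear_diagonal C, where u = v and w = v and x = m]
    by (simp add: q_def)
qed

text \<open>This is where the points at one third and two thirds of the chord come from. Put \<open>v = z - x\<close>,
  \<open>y = (x + 2z)/3\<close> and \<open>y' = (2x + z)/3\<close>. Since \<open>v = 3/2 (y - x) = -3/2 (y' - z)\<close>, the identity for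
  the transposed Jacobian gives
  \<open>2 Q(x, y) v = 3/2 (grad H y - DG x y) - D2(x, y) v\<close> and
  \<open>2 Q(z, y') v = -3/2 (grad H y' - DG z y') - D2(z, y') v\<close>.
  In the difference all terms occur in pairs that the reflection of the line in its midpoint \<open>m\<close>
  exchanges, so each pair is a central difference about \<open>(m, m)\<close> and no odd orders appear. Let \<open>A\<close> and
  \<open>B\<close> be the pure and the mixed second derivative of \<open>DG\<close> at \<open>(m, m)\<close> along \<open>v\<close>. The discrete
  gradient contributes \<open>(A - B)/4\<close> at second order and the correction \<open>- A/6 + B/3\<close>, and the sum
  \<open>(A + B)/12\<close> is the second derivative \<open>2A + 2B\<close> of \<open>grad H\<close> divided by \<open>24\<close>.\<close>

lemma corrected_discrete_gradient_expansion:
  "\<exists>M\<ge>0. \<forall>x\<in>cball c r. \<forall>z\<in>cball c r.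
     norm (DG x z
       + (1/2) *\<^sub>R ((Q_mat DG x ((1/3) *\<^sub>R (x + 2 *\<^sub>R z)) - Q_mat DG z ((1/3) *\<^sub>R (2 *\<^sub>R x + z))) *v (z - x))
       - grad H ((1/2) *\<^sub>R (x + z))
       - (1/24) *\<^sub>R ddir (z - x) (ddir (z - x) (grad H)) ((1/2) *\<^sub>R (x + z)))
     \<le> M * norm (z - x) ^ 4"
proof -
  define B where "B = cball c r"
  have convex_B: "convex B" by (simp add: B_def)
  define K where "K = B \<times> B"
  have K: "compact K" "convex K"
    by (auto simp: K_def B_def intro: compact_Times convex_Times)
  have C: "C_k 4 G" by (rule C_k_mono[OF C_DG]) simp
  obtain M1 where M1: "M1 \<ge> 0" "\<And>p u. p \<in> K \<Longrightarrow> p + u \<in> K \<Longrightarrow> p - u \<in> K \<Longrightarrow>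
    norm (G (p + u) + G (p - u) - 2 *\<^sub>R G p - ddir u (ddir u G) p) \<le> M1 * norm u ^ 4"
    using central_second_difference[OF C K] by blast
  obtain M2 where M2: "M2 \<ge> 0" "\<And>p u w. p \<in> K \<Longrightarrow> p + u \<in> K \<Longrightarrow> p - u \<in> K \<Longrightarrow>
    norm (ddir w G (p + u) - ddir w G (p - u) - 2 *\<^sub>R ddir u (ddir w G) p) \<le> M2 * norm w * norm u ^ 3"
    using central_difference_of_derivative[OF C K] by blast
  have "norm (DG x z
       + (1/2) *\<^sub>R ((Q_mat DG x ((1/3) *\<^sub>R (x + 2 *\<^sub>R z)) - Q_mat DG z ((1/3) *\<^sub>R (2 *\<^sub>R x + z))) *v (z - x))
       - grad H ((1/2) *\<^sub>R (x + z))
       - (1/24) *\<^sub>R ddir (z - x) (ddir (z - x) (grad H)) ((1/2) *\<^sub>R (x + z)))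
     \<le> (2 * M1 + M2) * norm (z - x) ^ 4" if x: "x \<in> B" and z: "z \<in> B" for x z
  proof -
    define v where "v = z - x"
    define m where "m = (1/2) *\<^sub>R (x + z)"
    define y where "y = (1/3) *\<^sub>R (x + 2 *\<^sub>R z)"
    define y' where "y' = (1/3) *\<^sub>R (2 *\<^sub>R x + z)"
    define a where "a = (v, 0 :: real^'n)"
    define b where "b = (0 :: real^'n, v)"
    define q where "q u w = ddir u (ddir w G) (m, m)" for u w
    \<comment> \<open>The displacements from \<open>(m, m)\<close> to the points \<open>(x, z)\<close>, \<open>(y, y)\<close> and \<open>(x, y)\<close>.\<close>
    define u0 where "u0 = (-1/2) *\<^sub>R a + (1/2) *\<^sub>R b"
    define u1 where "u1 = (1/6) *\<^sub>R a + (1/6) *\<^sub>R b"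
    define u2 where "u2 = (-1/2) *\<^sub>R a + (1/6) *\<^sub>R b"
    have inB: "m \<in> B" "y \<in> B" "y' \<in> B"
    proof -
      have "(1/2) *\<^sub>R x + (1/2) *\<^sub>R z \<in> B" "(1/3) *\<^sub>R x + (2/3) *\<^sub>R z \<in> B" "(2/3) *\<^sub>R x + (1/3) *\<^sub>R z \<in> B"
        using x z by (auto intro!: convexD[OF convex_B])
      then show "m \<in> B" "y \<in> B" "y' \<in> B"
        by (simp_all add: m_def y_def y'_def scaleR_add_right)
    qed
    have points: "(m, m) + u0 = (x, z)" "(m, m) - u0 = (z, x)" "(m, m) + u1 = (y, y)"
      "(m, m) - u1 = (y', y')" "(m, m) + u2 = (x, y)" "(m, m) - u2 = (z, y')"
      by (simp_all add: m_def y_def y'_def v_def a_def b_def u0_def u1_def u2_def vec_eq_iff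
          zero_prod_def plus_prod_def minus_prod_def field_simps)
    have q: "bilinear q"
      unfolding q_def by (rule bilinear_second_derivative) (rule C_k_mono[OF C], simp)
    have qab: "q b b = q a a" "q b a = q a b"
      using second_derivatives_on_diagonal(1,2)[where m = m and v = v]
      by (simp_all add: q_def a_def b_def)
    have N2: "ddir v (ddir v (grad H)) m = q (1 *\<^sub>R a + 1 *\<^sub>R b) (1 *\<^sub>R a + 1 *\<^sub>R b)"
      using second_derivatives_on_diagonal(3)[where m = m and v = v]
      by (simp add: q_def a_def b_def)
    have norms: "norm b = norm v" "norm u0 \<le> norm v" "norm u1 \<le> norm v" "norm u2 \<le> norm v"
      using norm_Pair_le[of v v] norm_ge_zero[of v]
      by (auto simp: a_def b_def u0_def u1_def u2_def intro!: order_trans[OF norm_Pair_le])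
    \<comment> \<open>The remainders of the four central differences; the next steps express the claim by them alone.\<close>
    define R0 where "R0 = DG x z + DG z x - 2 *\<^sub>R DG m m - q u0 u0"
    define R1 where "R1 = DG y y + DG y' y' - 2 *\<^sub>R DG m m - q u1 u1"
    define R2 where "R2 = DG x y + DG z y' - 2 *\<^sub>R DG m m - q u2 u2"
    define R3 where "R3 = ddir b G (x, y) - ddir b G (z, y') - 2 *\<^sub>R q u2 b"
    have mono: "M1 * norm u ^ 4 \<le> M1 * norm v ^ 4" "M2 * norm v * norm u ^ 3 \<le> M2 * norm v * norm v ^ 3"
      if "norm u \<le> norm v" for u :: "(real^'n) \<times> (real^'n)"
      using that M1(1) M2(1) by (auto intro!: mult_left_mono power_mono)
    have R: "norm R0 \<le> M1 * norm v ^ 4" "norm R1 \<le> M1 * norm v ^ 4"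
      "norm R2 \<le> M1 * norm v ^ 4" "norm R3 \<le> M2 * norm v ^ 4"
      using M1(2)[of "(m, m)" u0] M1(2)[of "(m, m)" u1] M1(2)[of "(m, m)" u2] M2(2)[of "(m, m)" u2 b]
        mono(1)[OF norms(2)] mono(1)[OF norms(3)] mono(1)[OF norms(4)] mono(2)[OF norms(4)]
      unfolding points by (auto simp: R0_def R1_def R2_def R3_def q_def K_def x z inB norms(1)
          eval_nat_numeral algebra_simps)
    have DGs: "DG z x = DG x z" "DG y y = grad H y" "DG y' y' = grad H y'" "DG m m = grad H m"
      using symm dg by (auto simp: symmetric_dg_def discrete_gradient_def)
    have Q1: "Q_mat DG x y *v v = (1/2) *\<^sub>R ((3/2) *\<^sub>R (grad H y - DG x y) - ddir b G (x, y))"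
    proof -
      have "v = (3/2) *\<^sub>R (y - x)"
        by (simp add: v_def y_def vec_eq_iff field_simps)
      then have "transpose (D2 DG x y) *v v = (3/2) *\<^sub>R (grad H y - DG x y)"
        by (metis D2_transpose_mult matrix_vector_mult_scaleR)
      then show ?thesis
        by (simp add: Q_mat_def D2_mult[symmetric] b_def matrix_vector_mult_diff_rdistrib
            scaleR_matrix_vector_assoc[symmetric])
    qed
    have Q2: "Q_mat DG z y' *v v = (1/2) *\<^sub>R ((-3/2) *\<^sub>R (grad H y' - DG z y') - ddir b G (z, y'))"
    proof -
      have "v = (-3/2) *\<^sub>R (y' - z)"
        by (simp add: v_def y'_def vec_eq_iff field_simps)
      then have "transpose (D2 DG z y') *v v = (-3/2) *\<^sub>R (grad H y' - DG z y')"
        by (metis D2_transpose_mult matrix_vector_mult_scaleR)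
      then show ?thesis
        by (simp add: Q_mat_def D2_mult[symmetric] b_def matrix_vector_mult_diff_rdistrib
            scaleR_matrix_vector_assoc[symmetric])
    qed
    \<comment> \<open>Brings the second argument into the form that \<open>bilinear_expand\<close> expects.\<close>
    have u2b: "q u2 b = q u2 (0 *\<^sub>R a + 1 *\<^sub>R b)" by simp
    have "DG x z + (1/2) *\<^sub>R ((Q_mat DG x y - Q_mat DG z y') *v v) - grad H m
         - (1/24) *\<^sub>R ddir v (ddir v (grad H)) m
       = (1/2) *\<^sub>R R0 + (3/8) *\<^sub>R R1 - (3/8) *\<^sub>R R2 - (1/4) *\<^sub>R R3"
      unfolding matrix_vector_mult_diff_rdistrib Q1 Q2 R0_def R1_def R2_def R3_def DGs N2 u2b
      unfolding u0_def u1_def u2_def bilinear_expand[OF q] qab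
      by (simp add: vec_eq_iff) (simp add: field_simps)
    also have "norm \<dots> \<le> (1/2) * norm R0 + (3/8) * norm R1 + (3/8) * norm R2 + (1/4) * norm R3"
      by (intro order_trans[OF norm_triangle_ineq4] order_trans[OF norm_triangle_ineq] add_mono) auto
    also have "\<dots> \<le> (2 * M1 + M2) * norm v ^ 4"
    proof -
      have "0 \<le> M1 * norm v ^ 4" "0 \<le> M2 * norm v ^ 4" using M1(1) M2(1) by auto
      then show ?thesis using R by (simp add: algebra_simps)
    qed
    finally show ?thesis by (simp add: v_def m_def y_def y'_def)
  qed
  moreover have "2 * M1 + M2 \<ge> 0" using M1(1) M2(1) by simp
  ultimately show ?thesis unfolding B_def by blast
qed

end

section \<open>Order of vanishing at step size zero\<close>

text \<open>The size of terms with values in arbitrary normed spaces, so that vectors and matrices can be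
  estimated alike. Only small \<open>h \<noteq> 0\<close> count, so a term may be divided by \<open>h\<close> at the cost of one
  order.\<close>

definition order_zero :: "nat \<Rightarrow> (real \<Rightarrow> 'a::real_normed_vector) \<Rightarrow> bool" where
  "order_zero k f \<longleftrightarrow> (\<lambda>h. norm (f h)) \<in> O[at 0](\<lambda>h. h ^ k)"

lemma order_zeroI:
  "\<forall>\<^sub>F h in at 0. norm (f h) \<le> C * \<bar>h\<bar> ^ k \<Longrightarrow> order_zero k f"
  unfolding order_zero_def by (rule bigoI[of _ C]) (simp add: power_abs)

lemma order_zeroE:
  assumes "order_zero k f"
  obtains C where "C > 0" "\<forall>\<^sub>F h in at 0. norm (f h) \<le> C * \<bar>h\<bar> ^ k"
  using landau_o.bigE[OF assms[unfolded order_zero_def]] that by (auto simp: power_abs)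

lemma order_zero_dominated:
  assumes "order_zero k g" "\<forall>\<^sub>F h in at 0. norm (f h) \<le> C * norm (g h)"
  shows "order_zero k f"
proof -
  from assms(1) obtain D where D: "\<forall>\<^sub>F h in at 0. norm (g h) \<le> D * \<bar>h\<bar> ^ k"
    by (rule order_zeroE)
  have "\<forall>\<^sub>F h in at 0. norm (f h) \<le> (\<bar>C\<bar> * D) * \<bar>h\<bar> ^ k"
    using D assms(2)
  proof eventually_elim
    case (elim h)
    have "norm (f h) \<le> \<bar>C\<bar> * norm (g h)"
      using elim(2) by (rule order_trans) (simp add: mult_right_mono)
    also have "\<dots> \<le> \<bar>C\<bar> * (D * \<bar>h\<bar> ^ k)"
      using elim(1) by (rule mult_left_mono) simp
    finally show ?case by (simp add: mult.assoc)
  qed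
  then show ?thesis by (rule order_zeroI)
qed

lemma order_zero_cong:
  assumes "order_zero k f" "\<And>h. h \<noteq> 0 \<Longrightarrow> f h = g h"
  shows "order_zero k g"
  by (rule order_zero_dominated[OF assms(1), of _ 1])
    (use assms(2) in \<open>auto simp: eventually_at_filter\<close>)

lemma order_zero_add: "order_zero k f \<Longrightarrow> order_zero k g \<Longrightarrow> order_zero k (\<lambda>h. f h + g h)"
proof (elim order_zeroE)
  fix C D
  assume "\<forall>\<^sub>F h in at 0. norm (f h) \<le> C * \<bar>h\<bar> ^ k" "\<forall>\<^sub>F h in at 0. norm (g h) \<le> D * \<bar>h\<bar> ^ k"
  then have "\<forall>\<^sub>F h in at 0. norm (f h + g h) \<le> (C + D) * \<bar>h\<bar> ^ k"
    by eventually_elim (simp add: distrib_right norm_triangle_le)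
  then show ?thesis by (rule order_zeroI)
qed

lemma order_zero_bilinear:
  assumes B: "bounded_bilinear B" and "order_zero j f" "order_zero k g"
  shows "order_zero (j + k) (\<lambda>h. B (f h) (g h))"
proof -
  obtain K where K: "K > 0" "\<And>a b. norm (B a b) \<le> norm a * norm b * K"
    using bounded_bilinear.pos_bounded[OF B] by blast
  obtain C where C: "C > 0" "\<forall>\<^sub>F h in at 0. norm (f h) \<le> C * \<bar>h\<bar> ^ j"
    using assms(2) by (rule order_zeroE)
  obtain D where D: "D > 0" "\<forall>\<^sub>F h in at 0. norm (g h) \<le> D * \<bar>h\<bar> ^ k"
    using assms(3) by (rule order_zeroE)
  have "\<forall>\<^sub>F h in at 0. norm (B (f h) (g h)) \<le> (C * D * K) * \<bar>h\<bar> ^ (j + k)"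
    using C(2) D(2)
  proof eventually_elim
    case (elim h)
    have "norm (B (f h) (g h)) \<le> norm (f h) * norm (g h) * K" by (rule K)
    also have "\<dots> \<le> (C * \<bar>h\<bar> ^ j) * (D * \<bar>h\<bar> ^ k) * K"
      using elim C(1) D(1) K(1) by (intro mult_mono) auto
    finally show ?case by (simp add: power_add mult_ac)
  qed
  then show ?thesis by (rule order_zeroI)
qed

lemma order_zero_linear:
  assumes "bounded_linear L" "order_zero k f"
  shows "order_zero k (\<lambda>h. L (f h))"
proof -
  obtain K where "\<And>a. norm (L a) \<le> norm a * K"
    using bounded_linear.bounded[OF assms(1)] by blast
  then show ?thesis
    by (intro order_zero_dominated[OF assms(2), of _ K] always_eventually) (simp add: mult.commute)
qed

lemma order_zero_scaleR: "order_zero k f \<Longrightarrow> order_zero k (\<lambda>h. c *\<^sub>R f h)"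
  by (rule order_zero_linear[OF bounded_linear_scaleR_right])

lemma order_zero_diff: "order_zero k f \<Longrightarrow> order_zero k g \<Longrightarrow> order_zero k (\<lambda>h. f h - g h)"
  using order_zero_add[of k f "\<lambda>h. (-1) *\<^sub>R g h"] order_zero_scaleR[of k g "-1"] by simp

lemma order_zero_power: "order_zero k (\<lambda>h. h ^ k)"
  by (rule order_zeroI[where C = 1]) (simp add: power_abs)

lemma order_zero_square_scaleR:
  assumes "order_zero k f"
  shows "order_zero (2 + k) (\<lambda>h. (h\<^sup>2 / c) *\<^sub>R f h)"
proof -
  have "order_zero (2 + k) (\<lambda>h. h\<^sup>2 *\<^sub>R f h)"
    by (rule order_zero_bilinear[OF bounded_bilinear_scaleR order_zero_power assms])
  from order_zero_scaleR[OF this, where c = "1 / c"] show ?thesis by simp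
qed

lemma order_zero_tendsto:
  assumes "(f \<longlongrightarrow> l) (at 0)"
  shows "order_zero 0 f"
proof (rule order_zeroI)
  have "\<forall>\<^sub>F h in at 0. norm (f h) < norm l + 1"
    using tendsto_norm[OF assms] by (rule order_tendstoD) simp
  then show "\<forall>\<^sub>F h in at 0. norm (f h) \<le> (norm l + 1) * \<bar>h\<bar> ^ 0"
    by eventually_elim simp
qed

lemma order_zero_mono: "order_zero k f \<Longrightarrow> j \<le> k \<Longrightarrow> order_zero j f"
proof -
  assume f: "order_zero k f" and "j \<le> k"
  then obtain i where k: "k = j + i" using le_Suc_ex by blast
  obtain C where C: "C > 0" "\<forall>\<^sub>F h in at 0. norm (f h) \<le> C * \<bar>h\<bar> ^ k"
    using f by (rule order_zeroE)
  have "\<forall>\<^sub>F h in at (0::real). \<bar>h\<bar> \<le> 1"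
    by (auto simp: eventually_at intro!: exI[of _ 1])
  with C(2) have "\<forall>\<^sub>F h in at 0. norm (f h) \<le> C * \<bar>h\<bar> ^ j"
  proof eventually_elim
    case (elim h)
    have "\<bar>h\<bar> ^ k \<le> \<bar>h\<bar> ^ j * 1"
      unfolding k power_add using elim(2) by (intro mult_left_mono power_le_one) auto
    with elim(1) C(1) show ?case
      by (smt (verit, best) mult_left_mono mult.right_neutral)
  qed
  then show ?thesis by (rule order_zeroI)
qed

lemma order_zero_divide:
  assumes "order_zero (Suc k) f"
  shows "order_zero k (\<lambda>h. (1 / h) *\<^sub>R f h)"
proof -
  obtain C where "\<forall>\<^sub>F h in at 0. norm (f h) \<le> C * \<bar>h\<bar> ^ Suc k"
    using assms by (rule order_zeroE)
  then have "\<forall>\<^sub>F h in at 0. norm ((1 / h) *\<^sub>R f h) \<le> C * \<bar>h\<bar> ^ k"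
    unfolding eventually_at_filter
    by eventually_elim (auto simp: field_simps)
  then show ?thesis by (rule order_zeroI)
qed

text \<open>Replacing the argument of a smooth function by a nearby one costs no more than the distance of
  the arguments. This is used to move all coefficients to one base point.\<close>

lemma order_zero_Lipschitz:
  fixes \<phi> :: "'a::euclidean_space \<Rightarrow> 'b::real_normed_vector"
  assumes \<phi>: "C_k 1 \<phi>" and f: "(f \<longlongrightarrow> p) (at 0)" and g: "(g \<longlongrightarrow> p) (at 0)"
    and fg: "order_zero k (\<lambda>h. f h - g h)"
  shows "order_zero k (\<lambda>h. \<phi> (f h) - \<phi> (g h))"
proof -
  obtain L where L: "\<forall>x\<in>cball p 1. \<forall>y\<in>cball p 1. norm (\<phi> x - \<phi> y) \<le> L * norm (x - y)"
    using C_1_Lipschitz_on_compact[OF \<phi> compact_cball convex_cball] by blast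
  have "\<forall>\<^sub>F h in at 0. f h \<in> cball p 1" "\<forall>\<^sub>F h in at 0. g h \<in> cball p 1"
    by (rule eventually_mono[OF tendstoD[OF f, of 1]], simp, simp add: dist_commute)
      (rule eventually_mono[OF tendstoD[OF g, of 1]], simp, simp add: dist_commute)
  then have "\<forall>\<^sub>F h in at 0. norm (\<phi> (f h) - \<phi> (g h)) \<le> L * norm (f h - g h)"
    by eventually_elim (use L in blast)
  with fg show ?thesis by (rule order_zero_dominated)
qed

lemma tendsto_C_k:
  assumes "C_k k \<phi>" "(f \<longlongrightarrow> p) F"
  shows "((\<lambda>h. \<phi> (f h)) \<longlongrightarrow> \<phi> p) F"
  using continuous_on_tendsto_compose[OF C_k_continuous_on[OF assms(1), of UNIV] assms(2)] by simp

section \<open>The implicit step\<close>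

text \<open>On the unit ball around \<open>x\<close> the map \<open>z \<mapsto> x + h \<Psi>(z, h)\<close> is a contraction with constant
  \<open>1/2\<close> once \<open>h\<close> is small, so the step is its unique fixed point there. A contraction with constant
  \<open>1/2\<close> moves a point at least half as far as the fixed point lies away; so an error estimate for
  the step needs only the defect of the curve to which it is compared.\<close>

lemma implicit_step:
  fixes \<Psi> :: "'a::euclidean_space \<times> real \<Rightarrow> 'a"
  assumes \<Psi>: "C_k 1 \<Psi>" and M: "\<And>z h. M x z h \<longleftrightarrow> z = x + h *\<^sub>R \<Psi> (z, h)"
  obtains \<phi> where "numerical_step M x \<phi>"
    and "\<And>k z. (z \<longlongrightarrow> x) (at 0) \<Longrightarrow> order_zero k (\<lambda>h. z h - x - h *\<^sub>R \<Psi> (z h, h)) \<Longrightarrow>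
      order_zero k (\<lambda>h. \<phi> h - z h)"
proof -
  define K where "K = cball x 1 \<times> cball (0::real) 1"
  have K: "compact K" "convex K"
    by (auto simp: K_def intro: compact_Times convex_Times)
  obtain L where L: "L \<ge> 0" "\<And>p q. p \<in> K \<Longrightarrow> q \<in> K \<Longrightarrow> norm (\<Psi> p - \<Psi> q) \<le> L * norm (p - q)"
    using C_1_Lipschitz_on_compact[OF \<Psi> K] by blast
  have "bounded (\<Psi> ` K)"
    by (rule compact_imp_bounded[OF compact_continuous_image[OF C_k_continuous_on[OF \<Psi>] K(1)]])
  then obtain B where B: "B > 0" "\<And>p. p \<in> K \<Longrightarrow> norm (\<Psi> p) \<le> B"
    by (auto simp: bounded_pos)
  \<comment> \<open>Small enough for the ball to be mapped into itself and for the contraction constant \<open>1/2\<close>.\<close>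
  define \<delta> where "\<delta> = min 1 (1 / (2 * (B + L)))"
  have \<delta>: "\<delta> > 0" using B(1) L(1) by (simp add: \<delta>_def)
  have small: "\<bar>h\<bar> \<le> 1 \<and> \<bar>h\<bar> * B \<le> 1/2 \<and> \<bar>h\<bar> * L \<le> 1/2" if "\<bar>h\<bar> < \<delta>" for h
  proof -
    have "\<bar>h\<bar> * (B + L) \<le> 1 / 2"
      using that B(1) L(1) by (simp add: \<delta>_def field_simps)
    moreover have "0 \<le> \<bar>h\<bar> * B" "0 \<le> \<bar>h\<bar> * L" using B(1) L(1) by auto
    moreover have "\<bar>h\<bar> \<le> 1" using that by (simp add: \<delta>_def)
    ultimately show ?thesis unfolding distrib_left by linarith
  qed
  have contr: "norm (h *\<^sub>R \<Psi> (z, h) - h *\<^sub>R \<Psi> (z', h)) \<le> 1/2 * norm (z - z')"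
    if "\<bar>h\<bar> < \<delta>" "z \<in> cball x 1" "z' \<in> cball x 1" for h z z'
  proof -
    have "norm (\<Psi> (z, h) - \<Psi> (z', h)) \<le> L * norm ((z, h) - (z', h))"
      using small[OF that(1)] that by (intro L) (auto simp: K_def)
    then have "\<bar>h\<bar> * norm (\<Psi> (z, h) - \<Psi> (z', h)) \<le> \<bar>h\<bar> * (L * norm (z - z'))"
      by (intro mult_left_mono) (auto simp: norm_Pair)
    also have "\<dots> \<le> 1/2 * norm (z - z')"
      using small[OF that(1)] unfolding mult.assoc[symmetric] by (intro mult_right_mono) auto
    finally show ?thesis by (simp add: scaleR_diff_right[symmetric])
  qed
  have bound: "norm (h *\<^sub>R \<Psi> (z, h)) \<le> \<bar>h\<bar> * B" if "\<bar>h\<bar> < \<delta>" "z \<in> cball x 1" for h z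
    using B(2)[of "(z, h)"] small[OF that(1)] that(2) by (auto simp: K_def intro!: mult_left_mono)
  have "\<exists>!z\<in>cball x 1. x + h *\<^sub>R \<Psi> (z, h) = z" if h: "\<bar>h\<bar> < \<delta>" for h
  proof (rule Banach_fix)
    show "complete (cball x 1)" by (simp add: complete_eq_closed)
    show "(\<lambda>z. x + h *\<^sub>R \<Psi> (z, h)) ` cball x 1 \<subseteq> cball x 1"
    proof (rule image_subsetI)
      fix z assume "z \<in> cball x 1"
      from bound[OF h this] small[OF h] show "x + h *\<^sub>R \<Psi> (z, h) \<in> cball x 1"
        by (simp add: dist_norm)
    qed
    show "dist (x + h *\<^sub>R \<Psi> (z, h)) (x + h *\<^sub>R \<Psi> (z', h)) \<le> 1/2 * dist z z'"
      if "z \<in> cball x 1" "z' \<in> cball x 1" for z z'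
      using contr[OF h] that by (auto simp: dist_norm)
  qed auto
  then obtain \<phi> where \<phi>: "\<And>h. \<bar>h\<bar> < \<delta> \<Longrightarrow> \<phi> h \<in> cball x 1 \<and> x + h *\<^sub>R \<Psi> (\<phi> h, h) = \<phi> h"
    and unique: "\<And>h z. \<bar>h\<bar> < \<delta> \<Longrightarrow> z \<in> cball x 1 \<Longrightarrow> x + h *\<^sub>R \<Psi> (z, h) = z \<Longrightarrow> z = \<phi> h"
    by metis
  have ev: "\<forall>\<^sub>F h in at (0::real). \<bar>h\<bar> < \<delta>"
    using \<delta> by (auto simp: eventually_at intro!: exI[of _ \<delta>])
  have close: "norm (\<phi> h - x) \<le> \<bar>h\<bar> * B" if "\<bar>h\<bar> < \<delta>" for h
    using bound[OF that] \<phi>[OF that] by (metis add_diff_cancel_left')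
  have "((\<lambda>h. \<phi> h - x) \<longlongrightarrow> 0) (at 0)"
  proof (rule Lim_null_comparison)
    show "\<forall>\<^sub>F h in at 0. norm (\<phi> h - x) \<le> \<bar>h\<bar> * B"
      using ev by eventually_elim (rule close)
    show "((\<lambda>h. \<bar>h\<bar> * B) \<longlongrightarrow> 0) (at 0)"
      by (auto intro!: tendsto_eq_intros)
  qed
  then have lim: "(\<phi> \<longlongrightarrow> x) (at 0)"
    by (simp add: Lim_null[symmetric])
  have "\<forall>\<^sub>F h in at 0. \<phi> h \<in> ball x 1 \<and> M x (\<phi> h) h \<and> (\<forall>z\<in>ball x 1. M x z h \<longrightarrow> z = \<phi> h)"
    using ev
  proof eventually_elim
    case (elim h)
    have "dist x (\<phi> h) < 1"
      using close[OF elim] small[OF elim] by (simp add: dist_norm norm_minus_commute)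
    then show ?case
      using \<phi>[OF elim] unique[OF elim] by (auto simp: M)
  qed
  with lim have step: "numerical_step M x \<phi>"
    unfolding numerical_step_def by (intro conjI exI[of _ 1]) auto
  show thesis
  proof (rule that[OF step])
    fix k z
    assume z: "(z \<longlongrightarrow> x) (at 0)" and defect: "order_zero k (\<lambda>h. z h - x - h *\<^sub>R \<Psi> (z h, h))"
    have "\<forall>\<^sub>F h in at 0. dist (z h) x < 1" using tendstoD[OF z, of 1] by simp
    with ev have "\<forall>\<^sub>F h in at 0. norm (\<phi> h - z h) \<le> 2 * norm (z h - x - h *\<^sub>R \<Psi> (z h, h))"
    proof eventually_elim
      case (elim h)
      let ?d = "z h - x - h *\<^sub>R \<Psi> (z h, h)"
      have fixed: "x + h *\<^sub>R \<Psi> (\<phi> h, h) = \<phi> h" and in_ball: "\<phi> h \<in> cball x 1"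
        using \<phi>[OF elim(1)] by auto
      have "\<phi> h - z h = (x + h *\<^sub>R \<Psi> (\<phi> h, h)) - z h"
        by (simp only: fixed)
      also have "\<dots> = (h *\<^sub>R \<Psi> (\<phi> h, h) - h *\<^sub>R \<Psi> (z h, h)) - ?d"
        by simp
      finally have "norm (\<phi> h - z h) \<le> norm (h *\<^sub>R \<Psi> (\<phi> h, h) - h *\<^sub>R \<Psi> (z h, h)) + norm ?d"
        by (metis norm_triangle_ineq4)
      also have "norm (h *\<^sub>R \<Psi> (\<phi> h, h) - h *\<^sub>R \<Psi> (z h, h)) \<le> 1/2 * norm (\<phi> h - z h)"
        using elim in_ball by (intro contr) (auto simp: dist_commute)
      finally show ?case by simp
    qed
    with defect show "order_zero k (\<lambda>h. \<phi> h - z h)"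
      by (rule order_zero_dominated)
  qed
qed

section \<open>The exact solution about its midpoint\<close>

text \<open>The Lie derivative of \<open>Y\<close> along the vector field \<open>F\<close>: for \<open>y' = F y\<close> it satisfies
  \<open>(Y \<circ> y)' = lie F Y \<circ> y\<close>. Its iterates on the identity are the higher derivatives of the
  solutions as functions of the state.\<close>

definition lie :: "('a::euclidean_space \<Rightarrow> 'a) \<Rightarrow> ('a \<Rightarrow> 'b::real_normed_vector) \<Rightarrow> 'a \<Rightarrow> 'b" where
  "lie F Y = (\<lambda>p. frechet_derivative Y (at p) (F p))"

lemma C_k_lie_power:
  assumes F: "C_k n F" and "i \<le> Suc n"
  shows "C_k (Suc n - i) ((lie F ^^ i) (\<lambda>p. p))"
  using assms(2)
proof (induction i)
  case 0
  show ?case by (simp add: C_k_bounded_linear[OF bounded_linear_ident] del: C_k.simps)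
next
  case (Suc i)
  have "C_k (Suc (n - i)) ((lie F ^^ i) (\<lambda>p. p))"
    using Suc by (simp add: Suc_diff_le del: C_k.simps)
  then have "C_k (n - i) (lie F ((lie F ^^ i) (\<lambda>p. p)))"
    unfolding lie_def by (rule C_k_ddir_along) (rule C_k_mono[OF F], simp)
  then show ?case by simp
qed

lemma lie_power_solution:
  assumes F: "C_k n F" and "i \<le> n" and y: "(y has_vector_derivative F (y s)) (at s)"
  shows "((\<lambda>s. (lie F ^^ i) (\<lambda>p. p) (y s)) has_vector_derivative (lie F ^^ Suc i) (\<lambda>p. p) (y s)) (at s)"
proof -
  let ?Y = "(lie F ^^ i) (\<lambda>p. p)"
  have C: "C_k (Suc (n - i)) ?Y"
    using C_k_lie_power[OF F, of i] assms(2) by (simp add: Suc_diff_le del: C_k.simps)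
  have lin: "linear (frechet_derivative ?Y (at p))" for p
    using C by (simp add: linear_frechet_derivative)
  have "((\<lambda>s. ?Y (y s)) has_derivative (\<lambda>h. frechet_derivative ?Y (at (y s)) (h *\<^sub>R F (y s)))) (at s)"
    by (rule has_derivative_compose[OF y[unfolded has_vector_derivative_def] C_k_has_derivative[OF C]])
  then show ?thesis
    by (simp add: has_vector_derivative_def linear_cmul[OF lin] lie_def)
qed

lemma solution_taylor:
  fixes F :: "'a::euclidean_space \<Rightarrow> 'a"
  assumes F: "C_k 4 F" and "n \<le> 5"
    and y: "\<And>s. \<bar>s - t\<bar> \<le> \<rho> \<Longrightarrow> (y has_vector_derivative F (y s)) (at s)"
  shows "\<exists>M. \<forall>c \<eta>. \<bar>c - t\<bar> + \<bar>\<eta>\<bar> \<le> \<rho> \<longrightarrow>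
    norm (y (c + \<eta>) - (\<Sum>i<n. (\<eta> ^ i / fact i) *\<^sub>R (lie F ^^ i) (\<lambda>p. p) (y c))) \<le> M * \<bar>\<eta>\<bar> ^ n"
proof -
  let ?Y = "\<lambda>i. (lie F ^^ i) (\<lambda>p. p)"
  let ?I = "{t - \<rho>..t + \<rho>}"
  have "continuous_on ?I y"
    by (intro continuous_at_imp_continuous_on ballI has_vector_derivative_continuous[OF y]) auto
  then have "continuous_on ?I (\<lambda>s. ?Y n (y s))"
    using C_k_lie_power[OF F, of n] assms(2)
    by (intro continuous_on_compose2[OF C_k_continuous_on[of _ "?Y n" UNIV]]) auto
  then have "bounded ((\<lambda>s. ?Y n (y s)) ` ?I)"
    by (intro compact_imp_bounded compact_continuous_image) auto
  then obtain M where M: "\<And>s. s \<in> ?I \<Longrightarrow> norm (?Y n (y s)) \<le> M"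
    unfolding bounded_iff by blast
  have "norm (y (c + \<eta>) - (\<Sum>i<n. (\<eta> ^ i / fact i) *\<^sub>R ?Y i (y c))) \<le> M * \<bar>\<eta>\<bar> ^ n"
    if c: "\<bar>c - t\<bar> + \<bar>\<eta>\<bar> \<le> \<rho>" for c \<eta>
  proof -
    have in_I: "\<bar>(c + s * \<eta>) - t\<bar> \<le> \<rho>" if "s \<in> {0..1}" for s
    proof -
      have "\<bar>s * \<eta>\<bar> \<le> \<bar>\<eta>\<bar>" using that by (auto simp: abs_mult intro: mult_left_le_one_le)
      with c show ?thesis by linarith
    qed
    define g where "g i s = \<eta> ^ i *\<^sub>R ?Y i (y (c + s * \<eta>))" for i s
    have "(g i has_vector_derivative g (Suc i) s) (at s within {0..1})" if i: "i < n" and s: "s \<in> {0..1}" for i s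
    proof -
      have "((\<lambda>s. ?Y i (y s)) has_vector_derivative ?Y (Suc i) (y (c + s * \<eta>))) (at (c + s * \<eta>))"
        by (rule lie_power_solution[OF F _ y[OF in_I[OF s]]]) (use i assms(2) in auto)
      moreover have "((\<lambda>s. c + s * \<eta>) has_vector_derivative \<eta>) (at s)"
        by (auto intro!: derivative_eq_intros)
      ultimately have "((\<lambda>s. ?Y i (y (c + s * \<eta>))) has_vector_derivative \<eta> *\<^sub>R ?Y (Suc i) (y (c + s * \<eta>))) (at s)"
        using vector_diff_chain_at[of "\<lambda>s. c + s * \<eta>" \<eta> s "\<lambda>s. ?Y i (y s)"] by (simp add: o_def)
      then have "((\<lambda>s. \<eta> ^ i *\<^sub>R ?Y i (y (c + s * \<eta>))) has_vector_derivative
          \<eta> ^ i *\<^sub>R (\<eta> *\<^sub>R ?Y (Suc i) (y (c + s * \<eta>)))) (at s)"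
        by (rule bounded_linear.has_vector_derivative[OF bounded_linear_scaleR_right])
      then show ?thesis
        unfolding g_def by (simp add: mult.commute has_vector_derivative_at_within)
    qed
    moreover have "norm (g n s) \<le> M * \<bar>\<eta>\<bar> ^ n" if "s \<in> {0..1}" for s
    proof -
      have "c + s * \<eta> \<in> ?I" using in_I[OF that] by (auto simp: abs_le_iff)
      from mult_right_mono[OF M[OF this], of "\<bar>\<eta>\<bar> ^ n"] show ?thesis
        by (simp add: g_def power_abs mult.commute)
    qed
    ultimately have "norm (g 0 1 - (\<Sum>i<n. (1 ^ i / fact i) *\<^sub>R g i 0)) \<le> M * \<bar>\<eta>\<bar> ^ n"
      by (intro taylor_unit_interval) auto
    then show ?thesis by (simp add: g_def)
  qed
  then show ?thesis by blast
qed

lemma taylor_odd_part: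
  fixes Y :: "nat \<Rightarrow> 'a::real_vector"
  shows "(\<Sum>i<5. ((h / 2) ^ i / fact i) *\<^sub>R Y i) - (\<Sum>i<5. ((- h / 2) ^ i / fact i) *\<^sub>R Y i)
    = h *\<^sub>R Y 1 + (h ^ 3 / 24) *\<^sub>R Y 3"
proof -
  have five: "{..<5::nat} = {0, 1, 2, 3, 4}" by auto
  have T: "(\<Sum>i<5. (c ^ i / fact i) *\<^sub>R Y i)
      = Y 0 + c *\<^sub>R Y 1 + (c ^ 2 / 2) *\<^sub>R Y 2 + (c ^ 3 / 6) *\<^sub>R Y 3 + (c ^ 4 / 24) *\<^sub>R Y 4" for c :: real
    unfolding five by (simp add: fact_numeral)
  have coeffs: "h / 2 - (- h / 2) = h" "(h / 2)\<^sup>2 / 2 - (- h / 2)\<^sup>2 / 2 = 0"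
    "(h / 2) ^ 3 / 6 - (- h / 2) ^ 3 / 6 = h ^ 3 / 24" "(h / 2) ^ 4 / 24 - (- h / 2) ^ 4 / 24 = 0"
    by (simp_all add: power_divide)
  have "(\<Sum>i<5. ((h / 2) ^ i / fact i) *\<^sub>R Y i) - (\<Sum>i<5. ((- h / 2) ^ i / fact i) *\<^sub>R Y i)
     = (h / 2 - (- h / 2)) *\<^sub>R Y 1 + ((h / 2)\<^sup>2 / 2 - (- h / 2)\<^sup>2 / 2) *\<^sub>R Y 2
       + ((h / 2) ^ 3 / 6 - (- h / 2) ^ 3 / 6) *\<^sub>R Y 3 + ((h / 2) ^ 4 / 24 - (- h / 2) ^ 4 / 24) *\<^sub>R Y 4"
    unfolding T scaleR_diff_left by simp
  then show ?thesis unfolding coeffs by simp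
qed
lemma taylor_even_part:
  fixes Y :: "nat \<Rightarrow> 'a::real_vector"
  shows "(\<Sum>i<4. ((h / 2) ^ i / fact i) *\<^sub>R Y i) + (\<Sum>i<4. ((- h / 2) ^ i / fact i) *\<^sub>R Y i)
    = 2 *\<^sub>R Y 0 + (h\<^sup>2 / 4) *\<^sub>R Y 2"
proof -
  have four: "{..<4::nat} = {0, 1, 2, 3}" by auto
  have T: "(\<Sum>i<4. (c ^ i / fact i) *\<^sub>R Y i)
      = Y 0 + c *\<^sub>R Y 1 + (c ^ 2 / 2) *\<^sub>R Y 2 + (c ^ 3 / 6) *\<^sub>R Y 3" for c :: real
    unfolding four by (simp add: fact_numeral)
  have coeffs: "h / 2 + - h / 2 = 0" "(h / 2)\<^sup>2 / 2 + (- h / 2)\<^sup>2 / 2 = h\<^sup>2 / 4"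
    "(h / 2) ^ 3 / 6 + (- h / 2) ^ 3 / 6 = 0"
    by (simp_all add: power_divide)
  have "(\<Sum>i<4. ((h / 2) ^ i / fact i) *\<^sub>R Y i) + (\<Sum>i<4. ((- h / 2) ^ i / fact i) *\<^sub>R Y i)
     = 2 *\<^sub>R Y 0 + (h / 2 + - h / 2) *\<^sub>R Y 1 + ((h / 2)\<^sup>2 / 2 + (- h / 2)\<^sup>2 / 2) *\<^sub>R Y 2
       + ((h / 2) ^ 3 / 6 + (- h / 2) ^ 3 / 6) *\<^sub>R Y 3"
    unfolding T scaleR_add_left by (simp add: scaleR_2)
  then show ?thesis unfolding coeffs by simp
qed

text \<open>Expanding about the middle \<open>P h\<close> of the time interval makes the chord purely odd and the
  deviation of the chord's midpoint from the curve purely even in \<open>h\<close>.\<close>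

lemma solution_midpoint_differences:
  fixes F :: "'a::euclidean_space \<Rightarrow> 'a"
  assumes F: "C_k 4 F" and y: "local_solution F y t x"
  defines "P \<equiv> \<lambda>h. y (t + h / 2)"
  shows "order_zero 5 (\<lambda>h. y (t + h) - x - h *\<^sub>R F (P h) - (h ^ 3 / 24) *\<^sub>R (lie F ^^ 3) (\<lambda>p. p) (P h))"
    and "order_zero 4 (\<lambda>h. (1/2) *\<^sub>R (x + y (t + h)) - P h - (h\<^sup>2 / 8) *\<^sub>R (lie F ^^ 2) (\<lambda>p. p) (P h))"
proof -
  let ?Y = "\<lambda>i. (lie F ^^ i) (\<lambda>p. p)"
  let ?T = "\<lambda>n \<eta> p. \<Sum>i<n. (\<eta> ^ i / fact i) *\<^sub>R ?Y i p"
  have "\<forall>\<^sub>F s in nhds t. (y has_vector_derivative F (y s)) (at s)"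
    using y by (simp add: local_solution_def)
  then obtain r where r: "r > 0" "\<And>s. dist s t < r \<Longrightarrow> (y has_vector_derivative F (y s)) (at s)"
    unfolding eventually_nhds_metric by blast
  define \<rho> where "\<rho> = r / 2"
  have \<rho>: "\<rho> > 0" "\<And>s. \<bar>s - t\<bar> \<le> \<rho> \<Longrightarrow> (y has_vector_derivative F (y s)) (at s)"
    using r by (auto simp: \<rho>_def dist_real_def)
  have ev: "\<forall>\<^sub>F h in at (0::real). \<bar>h\<bar> \<le> \<rho>"
    using \<rho>(1) by (auto simp: eventually_at intro!: exI[of _ \<rho>])
  have remainder: "order_zero n (\<lambda>h. y (t + h) - ?T n (h / 2) (P h))"
    "order_zero n (\<lambda>h. x - ?T n (- h / 2) (P h))" if n: "n \<le> 5" for n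
  proof -
    obtain M where M: "\<forall>c \<eta>. \<bar>c - t\<bar> + \<bar>\<eta>\<bar> \<le> \<rho> \<longrightarrow>
        norm (y (c + \<eta>) - ?T n \<eta> (y c)) \<le> M * \<bar>\<eta>\<bar> ^ n"
      by (rule exE[OF solution_taylor[OF F n, of t \<rho> y]]) (rule \<rho>(2))
    note M = M[rule_format]
    have "\<forall>\<^sub>F h in at 0. norm (y (t + h) - ?T n (h / 2) (P h)) \<le> (M / 2 ^ n) * \<bar>h\<bar> ^ n"
      using ev
    proof eventually_elim
      case (elim h)
      then show ?case using M[of "t + h / 2" "h / 2"] by (simp add: P_def power_divide add.commute)
    qed
    then show "order_zero n (\<lambda>h. y (t + h) - ?T n (h / 2) (P h))"
      by (rule order_zeroI)
    have yt: "y t = x" using y by (simp add: local_solution_def)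
    have "\<forall>\<^sub>F h in at 0. norm (x - ?T n (- h / 2) (P h)) \<le> (M / 2 ^ n) * \<bar>h\<bar> ^ n"
      using ev
    proof eventually_elim
      case (elim h)
      then show ?case using M[of "t + h / 2" "- h / 2"] by (simp add: P_def power_divide yt)
    qed
    then show "order_zero n (\<lambda>h. x - ?T n (- h / 2) (P h))"
      by (rule order_zeroI)
  qed
  have regroup5: "(z - A) - (w - B) = z - w - D - E" if "A - B = D + E" for z w A B D E :: 'a
  proof -
    have "(z - A) - (w - B) = z - w - (A - B)" by simp
    then show ?thesis unfolding that by simp
  qed
  have regroup4: "(1/2) *\<^sub>R ((z - A) + (w - B)) = (1/2) *\<^sub>R (w + z) - p - (h\<^sup>2 / 8) *\<^sub>R E"
    if "A + B = 2 *\<^sub>R p + (h\<^sup>2 / 4) *\<^sub>R E" for z w A B p E :: 'a and h :: real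
  proof -
    have eq: "(z - A) + (w - B) = (w + z) - (2 *\<^sub>R p + (h\<^sup>2 / 4) *\<^sub>R E)"
      unfolding that[symmetric] by simp
    show ?thesis unfolding eq by (simp add: scaleR_diff_right scaleR_add_right)
  qed
  have eq5: "(y (t + h) - ?T 5 (h / 2) (P h)) - (x - ?T 5 (- h / 2) (P h))
      = y (t + h) - x - h *\<^sub>R F (P h) - (h ^ 3 / 24) *\<^sub>R ?Y 3 (P h)" for h
  proof -
    have "?T 5 (h / 2) (P h) - ?T 5 (- h / 2) (P h) = h *\<^sub>R ?Y 1 (P h) + (h ^ 3 / 24) *\<^sub>R ?Y 3 (P h)"
      using taylor_odd_part[of h "\<lambda>i. ?Y i (P h)"] by (simp only:)
    moreover have "?Y 1 = F" by (simp add: lie_def)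
    ultimately have "?T 5 (h / 2) (P h) - ?T 5 (- h / 2) (P h) = h *\<^sub>R F (P h) + (h ^ 3 / 24) *\<^sub>R ?Y 3 (P h)"
      by (simp only:)
    then show ?thesis by (rule regroup5)
  qed
  show "order_zero 5 (\<lambda>h. y (t + h) - x - h *\<^sub>R F (P h) - (h ^ 3 / 24) *\<^sub>R ?Y 3 (P h))"
    by (rule order_zero_cong[OF order_zero_diff[OF remainder(1)[of 5] remainder(2)[of 5]] eq5]) simp_all
  have eq4: "(1/2) *\<^sub>R ((y (t + h) - ?T 4 (h / 2) (P h)) + (x - ?T 4 (- h / 2) (P h)))
      = (1/2) *\<^sub>R (x + y (t + h)) - P h - (h\<^sup>2 / 8) *\<^sub>R ?Y 2 (P h)" for h
  proof -
    have T: "?T 4 (h / 2) (P h) + ?T 4 (- h / 2) (P h) = 2 *\<^sub>R P h + (h\<^sup>2 / 4) *\<^sub>R ?Y 2 (P h)"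
      using taylor_even_part[of h "\<lambda>i. ?Y i (P h)"] by (simp only: funpow_0 id_apply)
    then show ?thesis by (rule regroup4)
  qed
  show "order_zero 4 (\<lambda>h. (1/2) *\<^sub>R (x + y (t + h)) - P h - (h\<^sup>2 / 8) *\<^sub>R ?Y 2 (P h))"
    by (rule order_zero_cong[OF order_zero_scaleR[OF order_zero_add[OF remainder(1)[of 4] remainder(2)[of 4]]] eq4])
      simp_all
qed

lemma second_derivative_basis:
  assumes "C_k 2 F"
  shows "ddir u (ddir w F) p = (\<Sum>b\<in>Basis. (w \<bullet> b) *\<^sub>R ddir u (ddir b F) p)"
proof -
  define q where "q u w = ddir u (ddir w F) p" for u w
  have "bilinear q"
    unfolding q_def by (rule bilinear_second_derivative[OF assms])
  then have lin: "linear (q u)"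
    by (simp add: bilinear_def)
  have "q u w = q u (\<Sum>b\<in>Basis. (w \<bullet> b) *\<^sub>R b)"
    by (simp add: euclidean_representation)
  also have "\<dots> = (\<Sum>b\<in>Basis. (w \<bullet> b) *\<^sub>R q u b)"
    by (simp add: linear_sum[OF lin] linear_cmul[OF lin])
  finally show ?thesis unfolding q_def .
qed

text \<open>With the direction as a second argument, \<open>F''(p)(u, u)\<close> can be compared at different \<open>p\<close> and
  \<open>u\<close> by one Lipschitz estimate.\<close>

lemma C_k_second_derivative_diagonal:
  fixes F :: "'a::euclidean_space \<Rightarrow> 'b::real_normed_vector"
  assumes F: "C_k (Suc (Suc k)) F"
  shows "C_k k (\<lambda>(p, u). ddir u (ddir u F) p)"
proof -
  have F2: "C_k 2 F" by (rule C_k_mono[OF F]) simp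
  have "ddir u (ddir u F) p = (\<Sum>b\<in>Basis. (u \<bullet> b) *\<^sub>R (\<Sum>c\<in>Basis. (u \<bullet> c) *\<^sub>R ddir c (ddir b F) p))" for p u
  proof -
    have C1: "C_k (Suc (Suc 0)) F" using F2 by (simp add: numeral_2_eq_2)
    have "ddir u (ddir u F) p = (\<Sum>b\<in>Basis. (u \<bullet> b) *\<^sub>R ddir u (ddir b F) p)"
      by (rule second_derivative_basis[OF F2])
    also have "\<dots> = (\<Sum>b\<in>Basis. (u \<bullet> b) *\<^sub>R (\<Sum>c\<in>Basis. (u \<bullet> c) *\<^sub>R ddir c (ddir b F) p))"
      by (intro sum.cong refl arg_cong[where f = "(*\<^sub>R) _"] ddir_basis[OF C_k_ddir[OF C1]])
    finally show ?thesis .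
  qed
  moreover have "C_k k (\<lambda>q :: 'a \<times> 'a. \<Sum>b\<in>Basis. (snd q \<bullet> b) *\<^sub>R (\<Sum>c\<in>Basis. (snd q \<bullet> c) *\<^sub>R ddir c (ddir b F) (fst q)))"
    by (intro C_k_sum C_k_bilinear[OF bounded_bilinear_scaleR]
        C_k_bounded_linear[OF bounded_linear_inner_left_comp[OF bounded_linear_snd]]
        C_k_linear_compose[OF bounded_linear_fst] C_k_ddir F)
  ultimately show ?thesis by (simp only: case_prod_unfold)
qed

text \<open>The product rule for \<open>F' F\<close>; with \<open>u = F p\<close> it is the third derivative
  \<open>F' F' F + F''(F, F)\<close> of the solutions.\<close>

lemma ddir_ddir_along:
  assumes F: "C_k 2 F"
  shows "ddir u (\<lambda>p. frechet_derivative F (at p) (F p)) p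
    = ddir (ddir u F p) F p + ddir u (ddir (F p) F) p"
proof -
  have C: "C_k (Suc 1) F" "C_k (Suc 0) (ddir b F)" for b
    using F by (simp_all add: numeral_2_eq_2)
  have "((\<lambda>p. \<Sum>b\<in>Basis. (F p \<bullet> b) *\<^sub>R ddir b F p) has_derivative
      (\<lambda>u. \<Sum>b\<in>Basis. (F p \<bullet> b) *\<^sub>R ddir u (ddir b F) p + (ddir u F p \<bullet> b) *\<^sub>R ddir b F p)) (at p)"
    by (intro has_derivative_sum has_derivative_scaleR has_derivative_inner_left
        C_k_has_derivative[OF C(1)] C_k_has_derivative[OF C(2)])
  moreover have "(\<lambda>p. \<Sum>b\<in>Basis. (F p \<bullet> b) *\<^sub>R ddir b F p) = (\<lambda>p. frechet_derivative F (at p) (F p))"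
    by (rule ext) (rule sym[OF ddir_basis[OF C(1)]])
  ultimately have der: "((\<lambda>p. frechet_derivative F (at p) (F p)) has_derivative
      (\<lambda>u. \<Sum>b\<in>Basis. (F p \<bullet> b) *\<^sub>R ddir u (ddir b F) p + (ddir u F p \<bullet> b) *\<^sub>R ddir b F p)) (at p)"
    by (simp only:)
  have "ddir u (\<lambda>p. frechet_derivative F (at p) (F p)) p
      = (\<Sum>b\<in>Basis. (F p \<bullet> b) *\<^sub>R ddir u (ddir b F) p) + (\<Sum>b\<in>Basis. (ddir u F p \<bullet> b) *\<^sub>R ddir b F p)"
    using fun_cong[OF frechet_derivative_at[OF der], of u] by (simp only: sum.distrib)
  then show ?thesis
    unfolding second_derivative_basis[OF F, where u = u and w = "F p" and p = p, symmetric]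
      ddir_basis[OF C(1), where x = p and v = "ddir u F p", symmetric]
    by (simp only: add.commute)
qed

text \<open>With \<open>m\<close> the midpoint of the chord and \<open>u\<close> the chord divided by \<open>h\<close>, so that \<open>h\<^sup>2 F''(m)(u, u)\<close>
  is the second derivative along the chord. At the point \<open>P\<close> of the curve,
  \<open>u = F + h\<^sup>2/24 (F' F' F + F''(F, F)) + O(h\<^sup>4)\<close> and \<open>m = P + h\<^sup>2/8 F' F + O(h\<^sup>4)\<close>, whence
  \<open>F m = F + h\<^sup>2/8 F' F' F + O(h\<^sup>4)\<close>. Eliminating \<open>F\<close> leaves the coefficient \<open>1/24 - 1/8 = -1/12\<close> at
  \<open>F' F' F\<close>. In terms that carry \<open>h\<^sup>2\<close> the base point and the direction may be changed by \<open>O(h\<^sup>2)\<close>,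
  which moves them from \<open>P\<close> and \<open>F P\<close> to \<open>m\<close> and \<open>u\<close>.\<close>

lemma solution_midpoint_expansion:
  fixes F :: "'a::euclidean_space \<Rightarrow> 'a"
  assumes F: "C_k 4 F" and y: "local_solution F y t x"
  defines "m \<equiv> \<lambda>h. (1/2) *\<^sub>R (x + y (t + h))" and "u \<equiv> \<lambda>h. (1 / h) *\<^sub>R (y (t + h) - x)"
  shows "order_zero 4 (\<lambda>h. u h - F (m h) - (h\<^sup>2 / 24) *\<^sub>R ddir (u h) (ddir (u h) F) (m h)
      + (h\<^sup>2 / 12) *\<^sub>R ddir (ddir (F (m h)) F (m h)) F (m h))"
    and "order_zero 2 (\<lambda>h. F (m h) - u h)"
    and "((\<lambda>h. y (t + h)) \<longlongrightarrow> x) (at 0)" and "(u \<longlongrightarrow> F x) (at 0)"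
proof -
  define P where "P h = y (t + h / 2)" for h
  define W where "W p = ddir (ddir (F p) F p) F p" for p
  define \<Phi> where "\<Phi> = (\<lambda>(p, u). ddir u (ddir u F) p)"
  let ?Y = "\<lambda>i. (lie F ^^ i) (\<lambda>p. p)"
  have yt: "y t = x" using y by (simp add: local_solution_def)
  have "\<forall>\<^sub>F s in nhds t. (y has_vector_derivative F (y s)) (at s)"
    using y by (simp add: local_solution_def)
  then have dy: "(y has_vector_derivative F x) (at t)"
    using eventually_nhds_x_imp_x yt by metis
  have shift: "((\<lambda>h. t + c * h) \<longlongrightarrow> t) (at 0)" for c
    by (auto intro!: tendsto_eq_intros)
  have isCont: "isCont y t"
    using has_vector_derivative_continuous[OF dy] .
  have z_lim: "((\<lambda>h. y (t + h)) \<longlongrightarrow> x) (at 0)"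
    using isCont_tendsto_compose[OF isCont shift[of 1]] yt by simp
  then show "((\<lambda>h. y (t + h)) \<longlongrightarrow> x) (at 0)" .
  have P_lim: "(P \<longlongrightarrow> x) (at 0)"
    using isCont_tendsto_compose[OF isCont shift[of "1/2"]] yt by (simp add: P_def[abs_def])
  have m_lim: "(m \<longlongrightarrow> x) (at 0)"
  proof -
    have "(m \<longlongrightarrow> (1/2) *\<^sub>R (x + x)) (at 0)"
      unfolding m_def by (intro tendsto_intros z_lim)
    then show ?thesis by (simp flip: scaleR_2)
  qed
  have FP_lim: "((\<lambda>h. F (P h)) \<longlongrightarrow> F x) (at 0)"
    by (rule tendsto_C_k[OF F P_lim])
  have Y2: "?Y 2 p = ddir (F p) F p" for p
    by (simp add: numeral_2_eq_2 lie_def)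
  have C2: "C_k 2 F" by (rule C_k_mono[OF F]) simp
  have Y3: "?Y 3 p = W p + \<Phi> (p, F p)" for p
  proof -
    have "?Y 3 p = ddir (F p) (\<lambda>p. frechet_derivative F (at p) (F p)) p"
      by (simp add: numeral_3_eq_3 lie_def)
    also have "\<dots> = W p + \<Phi> (p, F p)"
      by (simp only: ddir_ddir_along[OF C2] W_def \<Phi>_def case_prod_conv)
    finally show ?thesis .
  qed
  note odd = solution_midpoint_differences(1)[OF F y, folded P_def]
  note even = solution_midpoint_differences(2)[OF F y, folded P_def]
  have even': "order_zero 4 (\<lambda>h. m h - P h - (h\<^sup>2 / 8) *\<^sub>R ?Y 2 (P h))"
    unfolding m_def by (rule even)
  have C_Y: "C_k 1 (?Y 2)" "C_k 1 (?Y 3)"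
    by (rule C_k_mono[OF C_k_lie_power[OF F]]; simp)+
  have u_P: "order_zero 4 (\<lambda>h. u h - F (P h) - (h\<^sup>2 / 24) *\<^sub>R ?Y 3 (P h))"
  proof -
    have a: "order_zero 4 (\<lambda>h. (1 / h) *\<^sub>R (y (t + h) - x - h *\<^sub>R F (P h) - (h ^ 3 / 24) *\<^sub>R ?Y 3 (P h)))"
      by (rule order_zero_divide) (use odd in simp)
    have b: "(1 / h) *\<^sub>R (y (t + h) - x - h *\<^sub>R F (P h) - (h ^ 3 / 24) *\<^sub>R ?Y 3 (P h))
        = u h - F (P h) - (h\<^sup>2 / 24) *\<^sub>R ?Y 3 (P h)" if "h \<noteq> 0" for h
      using that by (simp add: u_def scaleR_diff_right power3_eq_cube power2_eq_square)
    show ?thesis by (rule order_zero_cong[OF a b])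
  qed
  have quadratic: "order_zero 2 (\<lambda>h. (h\<^sup>2 / c) *\<^sub>R g h)" if "(g \<longlongrightarrow> l) (at 0)" for c l and g :: "real \<Rightarrow> 'a"
    using order_zero_square_scaleR[OF order_zero_tendsto[OF that], of c] by simp
  have u_FP: "order_zero 2 (\<lambda>h. u h - F (P h))"
    using order_zero_add[OF order_zero_mono[OF u_P] quadratic[OF tendsto_C_k[OF C_Y(2) P_lim], of 24]]
    by simp
  have m_P: "order_zero 2 (\<lambda>h. m h - P h)"
    using order_zero_add[OF order_zero_mono[OF even] quadratic[OF tendsto_C_k[OF C_Y(1) P_lim], of 8]]
    by (simp add: m_def)
  have u_lim: "(u \<longlongrightarrow> F x) (at 0)"
  proof -
    obtain C where "\<forall>\<^sub>F h in at 0. norm (u h - F (P h)) \<le> C * \<bar>h\<bar>\<^sup>2"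
      using u_FP by (rule order_zeroE)
    moreover have "((\<lambda>h::real. C * \<bar>h\<bar>\<^sup>2) \<longlongrightarrow> 0) (at 0)"
      by (auto intro!: tendsto_eq_intros)
    ultimately have "((\<lambda>h. u h - F (P h)) \<longlongrightarrow> 0) (at 0)"
      by (rule Lim_null_comparison)
    from tendsto_add[OF this FP_lim] show ?thesis by simp
  qed
  then show "(u \<longlongrightarrow> F x) (at 0)" .
  have F_mP: "order_zero 2 (\<lambda>h. F (m h) - F (P h))"
    by (rule order_zero_Lipschitz[OF C_k_mono[OF F] m_lim P_lim m_P]) simp
  from order_zero_diff[OF F_mP u_FP] show "order_zero 2 (\<lambda>h. F (m h) - u h)"
    by simp
  have C_W: "C_k 1 W"
    unfolding W_def by (intro C_k_ddir_along C_k_mono[OF F]) simp_all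
  have W_mP: "order_zero 2 (\<lambda>h. W (m h) - W (P h))"
    by (rule order_zero_Lipschitz[OF C_W m_lim P_lim m_P])
  have \<Phi>_mP: "order_zero 2 (\<lambda>h. \<Phi> (m h, u h) - \<Phi> (P h, F (P h)))"
  proof -
    have a: "C_k 1 \<Phi>"
      unfolding \<Phi>_def by (rule C_k_second_derivative_diagonal, rule C_k_mono[OF F]) simp
    have b: "((\<lambda>h. (m h, u h)) \<longlongrightarrow> (x, F x)) (at 0)" "((\<lambda>h. (P h, F (P h))) \<longlongrightarrow> (x, F x)) (at 0)"
      by (intro tendsto_Pair m_lim u_lim P_lim FP_lim)+
    have "order_zero 2 (\<lambda>h. (m h - P h, 0 :: 'a) + (0 :: 'a, u h - F (P h)))"
      by (intro order_zero_add order_zero_linear[OF bounded_linear_Pair_0_left u_FP]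
          order_zero_linear[OF bounded_linear_Pair[OF bounded_linear_ident bounded_linear_zero] m_P])
    then have "order_zero 2 (\<lambda>h. (m h, u h) - (P h, F (P h)))" by simp
    from order_zero_Lipschitz[OF a b this] show ?thesis .
  qed
  have F_expand: "order_zero 4 (\<lambda>h. F (m h) - F (P h) - (h\<^sup>2 / 8) *\<^sub>R W (P h))"
  proof -
    obtain M where M: "\<forall>p v. p \<in> cball x 1 \<longrightarrow> p + v \<in> cball x 1 \<longrightarrow>
        norm (F (p + v) - (\<Sum>i<2. (1 / fact i) *\<^sub>R iterdir (replicate i v) F p)) \<le> M * norm v ^ 2"
      using taylor_compact_convex[OF C2 compact_cball convex_cball, of x 1] by blast
    have C1: "C_k (Suc 0) F" by (rule C_k_mono[OF F]) simp
    obtain N where N: "\<forall>us. length us = Suc 0 \<longrightarrow> (\<forall>p\<in>cball x 1. norm (iterdir us F p) \<le> N * prod_list (map norm us))"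
      using iterdir_bound[OF compact_cball[of x 1] C1] by blast
    have evm: "\<forall>\<^sub>F h in at 0. m h \<in> cball x 1"
      by (rule eventually_mono[OF tendstoD[OF m_lim, of 1]]) (simp_all add: dist_commute)
    have evP: "\<forall>\<^sub>F h in at 0. P h \<in> cball x 1"
      by (rule eventually_mono[OF tendstoD[OF P_lim, of 1]]) (simp_all add: dist_commute)
    have "order_zero (2 + 2) (\<lambda>h. (norm (m h - P h)) * (norm (m h - P h)))"
      by (rule order_zero_bilinear[OF bounded_bilinear_mult];
          rule order_zero_dominated[OF m_P, of _ 1]; simp)
    moreover have "\<forall>\<^sub>F h in at 0. norm (F (m h) - F (P h) - ddir (m h - P h) F (P h))
        \<le> M * norm ((norm (m h - P h)) * (norm (m h - P h)))"
      using evm evP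
    proof eventually_elim
      case (elim h)
      have "norm (F (P h + (m h - P h)) - (\<Sum>i<2. (1 / fact i) *\<^sub>R iterdir (replicate i (m h - P h)) F (P h)))
          \<le> M * norm (m h - P h) ^ 2"
        by (rule M[rule_format]) (use elim in simp_all)
      then show ?case by (simp add: numeral_2_eq_2 diff_diff_eq)
    qed
    ultimately have 1: "order_zero 4 (\<lambda>h. F (m h) - F (P h) - ddir (m h - P h) F (P h))"
      using order_zero_dominated by fastforce
    have "\<forall>\<^sub>F h in at 0. norm (ddir (m h - P h - (h\<^sup>2 / 8) *\<^sub>R ?Y 2 (P h)) F (P h))
        \<le> N * norm (m h - P h - (h\<^sup>2 / 8) *\<^sub>R ?Y 2 (P h))"
      using evP
    proof eventually_elim
      case (elim h)
      from N[rule_format, of "[m h - P h - (h\<^sup>2 / 8) *\<^sub>R ?Y 2 (P h)]", OF _ elim]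
      show ?case by simp
    qed
    then have 2: "order_zero 4 (\<lambda>h. ddir (m h - P h - (h\<^sup>2 / 8) *\<^sub>R ?Y 2 (P h)) F (P h))"
      by (rule order_zero_dominated[OF even'])
    have eq: "ddir (m h - P h - (h\<^sup>2 / 8) *\<^sub>R ?Y 2 (P h)) F (P h)
        = ddir (m h - P h) F (P h) - (h\<^sup>2 / 8) *\<^sub>R W (P h)" for h
    proof -
      have lin: "linear (frechet_derivative F (at (P h)))"
        using C1 by (simp add: linear_frechet_derivative)
      show ?thesis
        by (simp only: linear_diff[OF lin] linear_cmul[OF lin] W_def Y2)
    qed
    from order_zero_add[OF 1 2[unfolded eq]] show ?thesis by simp
  qed
  have four: "order_zero 4 (\<lambda>h. (h\<^sup>2 / c) *\<^sub>R g h)" if "order_zero 2 g" for c and g :: "real \<Rightarrow> 'a"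
    using order_zero_square_scaleR[OF that, of c] by simp
  have "order_zero 4 (\<lambda>h. (u h - F (P h) - (h\<^sup>2 / 24) *\<^sub>R ?Y 3 (P h))
      - (F (m h) - F (P h) - (h\<^sup>2 / 8) *\<^sub>R W (P h))
      - (h\<^sup>2 / 24) *\<^sub>R (\<Phi> (m h, u h) - \<Phi> (P h, F (P h)))
      + (h\<^sup>2 / 12) *\<^sub>R (W (m h) - W (P h)))"
    by (intro order_zero_add order_zero_diff u_P F_expand four \<Phi>_mP W_mP)
  moreover have "(U - FP - (h\<^sup>2 / 24) *\<^sub>R (w + p)) - (Fm - FP - (h\<^sup>2 / 8) *\<^sub>R w)
      - (h\<^sup>2 / 24) *\<^sub>R (p' - p) + (h\<^sup>2 / 12) *\<^sub>R (w' - w)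
      = U - Fm - (h\<^sup>2 / 24) *\<^sub>R p' + (h\<^sup>2 / 12) *\<^sub>R w'" for U FP Fm w p p' w' :: 'a and h :: real
  proof -
    have "(h\<^sup>2 / 8) *\<^sub>R w = (h\<^sup>2 / 24) *\<^sub>R w + (h\<^sup>2 / 12) *\<^sub>R w"
      by (simp flip: scaleR_add_left)
    then show ?thesis by (simp add: scaleR_diff_right scaleR_add_right)
  qed
  ultimately have "order_zero 4 (\<lambda>h. u h - F (m h) - (h\<^sup>2 / 24) *\<^sub>R \<Phi> (m h, u h) + (h\<^sup>2 / 12) *\<^sub>R W (m h))"
    unfolding Y3 by (simp only:)
  then show "order_zero 4 (\<lambda>h. u h - F (m h) - (h\<^sup>2 / 24) *\<^sub>R ddir (u h) (ddir (u h) F) (m h)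
      + (h\<^sup>2 / 12) *\<^sub>R ddir (ddir (F (m h)) F (m h)) F (m h))"
    by (simp only: \<Phi>_def W_def case_prod_conv)
qed

section \<open>The corrected step\<close>

lemma bounded_bilinear_matrix_matrix_mult:
  "bounded_bilinear (\<lambda>(A :: real^'n^'m) (B :: real^'k^'n). A ** B)"
  unfolding bilinear_conv_bounded_bilinear[symmetric] bilinear_def
  by (auto intro!: linearI simp: matrix_matrix_mult_def vec_eq_iff sum.distrib sum_distrib_left
      algebra_simps)

lemma bounded_bilinear_matrix_vector_mult:
  "bounded_bilinear (\<lambda>(A :: real^'n^'m) (v :: real^'n). A *v v)"
  unfolding bilinear_conv_bounded_bilinear[symmetric] bilinear_def
  by (auto intro!: linearI simp: matrix_vector_mult_def vec_eq_iff sum.distrib sum_distrib_left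
      algebra_simps)

lemma bounded_linear_transpose: "bounded_linear (transpose :: real^'n^'m \<Rightarrow> real^'m^'n)"
  unfolding linear_conv_bounded_linear[symmetric]
  by (auto intro!: linearI simp: transpose_def vec_eq_iff)

lemma C_k_matrixI:
  fixes A :: "'a::euclidean_space \<Rightarrow> real^'n^'m"
  assumes "\<And>w. C_k k (\<lambda>x. A x *v w)"
  shows "C_k k A"
proof (rule C_k_componentwise)
  fix b :: "real^'n^'m"
  assume "b \<in> Basis"
  then obtain i j where b: "b = axis i (axis j 1)"
    by (auto simp: Basis_vec_def)
  have "A x \<bullet> b = (A x *v axis j 1) \<bullet> axis i 1" for x
    by (simp add: b inner_axis matrix_vector_mult_basis column_def)
  moreover have "C_k k (\<lambda>x. (A x *v axis j 1) \<bullet> axis i 1)"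
    by (rule C_k_linear_image[OF bounded_linear_inner_left assms])
  ultimately show "C_k k (\<lambda>x. A x \<bullet> b)" by simp
qed

context smooth_symmetric_discrete_gradient
begin

lemma C_hessian: "C_k 4 (hessian H)"
  by (rule C_k_matrixI) (unfold hessian_mult, rule C_k_ddir, use C_grad in \<open>simp del: C_k.simps\<close>)

lemma C_D2: "C_k 4 (\<lambda>(x, z). D2 DG x z)"
proof (rule C_k_matrixI)
  fix w
  have "(\<lambda>p. (case p of (x, z) \<Rightarrow> D2 DG x z) *v w) = ddir (0, w) G"
    by (auto simp: D2_mult)
  moreover have "C_k 4 (ddir (0, w) G)"
    by (rule C_k_ddir) (use C_DG in \<open>simp del: C_k.simps\<close>)
  ultimately show "C_k 4 (\<lambda>p. (case p of (x, z) \<Rightarrow> D2 DG x z) *v w)" by (simp only:)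
qed

lemma C_Q_mat: "C_k 4 (\<lambda>(x, z). Q_mat DG x z)"
proof -
  have "C_k 4 (\<lambda>p. (1/2) *\<^sub>R (transpose ((\<lambda>(x, z). D2 DG x z) p) - (\<lambda>(x, z). D2 DG x z) p))"
    by (intro C_k_scaleR C_k_diff C_k_linear_image[OF bounded_linear_transpose] C_D2)
  then show ?thesis by (simp only: Q_mat_def case_prod_unfold)
qed

lemma C_Q_mat_difference:
  "C_k 4 (\<lambda>z. Q_mat DG x ((1/3) *\<^sub>R (x + 2 *\<^sub>R z)) - Q_mat DG z ((1/3) *\<^sub>R (2 *\<^sub>R x + z)))"
proof -
  have 1: "bounded_linear (\<lambda>z::real^'n. (0 :: real^'n, (2/3) *\<^sub>R z))"
    by (intro bounded_linear_Pair bounded_linear_zero bounded_linear_scaleR_right)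
  have 2: "bounded_linear (\<lambda>z::real^'n. (z, (1/3) *\<^sub>R z))"
    by (intro bounded_linear_Pair bounded_linear_ident bounded_linear_scaleR_right)
  from C_k_diff[OF C_k_affine[OF 1 C_Q_mat, of "(x, (1/3) *\<^sub>R x)"]
      C_k_affine[OF 2 C_Q_mat, of "(0, (2/3) *\<^sub>R x)"]]
  show ?thesis by (simp add: scaleR_add_right)
qed

lemma C_step_map: "C_k 1 (\<lambda>(z, h). S4 S H DG x z h *v DG x z)"
proof -
  have hess: "C_k 1 (\<lambda>p::(real^'n) \<times> real. hessian H ((1/2) *\<^sub>R (x + fst p)))"
    using C_k_affine[OF bounded_linear_compose[OF bounded_linear_scaleR_right bounded_linear_fst],
        of 1 "hessian H" "(1/2) *\<^sub>R x" "1/2"] C_k_mono[OF C_hessian, of 1]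
    by (simp add: scaleR_add_right del: C_k.simps One_nat_def)
  have Q: "C_k 1 (\<lambda>p::(real^'n) \<times> real. Q_mat DG x ((1/3) *\<^sub>R (x + 2 *\<^sub>R fst p)) - Q_mat DG (fst p) ((1/3) *\<^sub>R (2 *\<^sub>R x + fst p)))"
    by (rule C_k_linear_compose[OF bounded_linear_fst C_k_mono[OF C_Q_mat_difference]]) simp
  have DGx: "C_k 1 (\<lambda>p::(real^'n) \<times> real. DG x (fst p))"
    using C_k_affine[OF bounded_linear_compose[OF bounded_linear_Pair_0_left bounded_linear_fst],
        of 1 G "(x, 0)"] C_k_mono[OF C_DG, of 1]
    by (simp del: C_k.simps One_nat_def)
  have h: "C_k 1 (\<lambda>p::(real^'n) \<times> real. snd p)"
    by (rule C_k_bounded_linear[OF bounded_linear_snd])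
  have h1: "C_k 1 (\<lambda>p::(real^'n) \<times> real. snd p / 2)"
    by (rule C_k_linear_image[OF bounded_linear_divide h])
  have h2: "C_k 1 (\<lambda>p::(real^'n) \<times> real. (snd p)\<^sup>2 / 12)"
    unfolding power2_eq_square
    by (rule C_k_linear_image[OF bounded_linear_divide C_k_bilinear[OF bounded_bilinear_mult h h]])
  show ?thesis
    unfolding S4_def case_prod_unfold
    by (intro C_k_bilinear[OF bounded_bilinear_matrix_vector_mult] C_k_add C_k_diff
        C_k_bilinear[OF bounded_bilinear_scaleR] C_k_bilinear[OF bounded_bilinear_matrix_matrix_mult]
        C_k_const h1 h2 hess Q DGx)
qed

text \<open>The correction terms are odd palindromic products: \<open>S Q S\<close> has three skew factors, and
  \<open>S N S N S\<close> with symmetric \<open>N\<close> again has three.\<close>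

lemma S4_skew:
  assumes S: "transpose S = - S"
  shows "transpose (S4 S H DG x z h) = - S4 S H DG x z h"
proof -
  have neg: "(- A) ** B = - (A ** B)" "A ** (- B) = - (A ** B)" for A B :: "real^'n^'n"
    using bounded_bilinear.minus_left[OF bounded_bilinear_matrix_matrix_mult]
      bounded_bilinear.minus_right[OF bounded_bilinear_matrix_matrix_mult] by blast+
  have tr: "transpose (A + B) = transpose A + transpose B" "transpose (A - B) = transpose A - transpose B"
    "transpose (c *\<^sub>R A) = c *\<^sub>R transpose A" for A B :: "real^'n^'n" and c
    by (simp_all add: transpose_def vec_eq_iff)
  have Q: "transpose (Q_mat DG a b) = - Q_mat DG a b" for a b
    by (simp add: Q_mat_def tr flip: scaleR_minus_right)
  show ?thesis
    by (simp add: S4_def tr matrix_transpose_mul S Q hessian_symmetric neg matrix_mul_assoc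
        bounded_bilinear.diff_left[OF bounded_bilinear_matrix_matrix_mult]
        bounded_bilinear.diff_right[OF bounded_bilinear_matrix_matrix_mult] scaleR_diff_right)
qed

text \<open>Write \<open>\<Delta>\<close> for the difference of the two matrices \<open>Q\<close>, \<open>g\<close> for the discrete gradient and \<open>N\<close>
  for the Hessian at the midpoint. As \<open>\<Delta>\<close> vanishes at \<open>z = x\<close> it is \<open>O(h)\<close>, and \<open>h S g = v + O(h\<^sup>3)\<close>
  for the chord \<open>v\<close>; so \<open>h/2 S \<Delta> S g\<close> may be replaced by \<open>1/2 S \<Delta> v\<close>, and the corrected discrete
  gradient \<open>g + 1/2 \<Delta> v\<close> appears, whose expansion is known. Likewise \<open>N S N S g\<close> differs by
  \<open>O(h\<^sup>2)\<close> from \<open>N S N S grad H m\<close>, and for \<open>F = S grad H\<close> one has \<open>S N S N S grad H = F' F' F\<close>. These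
  are the terms of the midpoint expansion of the exact solution.\<close>

lemma exact_solution_defect:
  fixes S :: "real^'n^'n"
  assumes y: "local_solution (\<lambda>x. S *v grad H x) y t x"
  shows "((\<lambda>h. y (t + h)) \<longlongrightarrow> x) (at 0)"
    and "order_zero 5 (\<lambda>h. y (t + h) - x - h *\<^sub>R (S4 S H DG x (y (t + h)) h *v DG x (y (t + h))))"
proof -
  define F where "F = (\<lambda>x. S *v grad H x)"
  define z where "z h = y (t + h)" for h
  define m where "m h = (1/2) *\<^sub>R (x + z h)" for h
  define u where "u h = (1/h) *\<^sub>R (z h - x)" for h
  define g where "g h = DG x (z h)" for h
  define N where "N h = hessian H (m h)" for h
  define \<Delta> where "\<Delta> z = Q_mat DG x ((1/3) *\<^sub>R (x + 2 *\<^sub>R z)) - Q_mat DG z ((1/3) *\<^sub>R (2 *\<^sub>R x + z))" for z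
  define \<Theta> where "\<Theta> h = ddir (u h) (ddir (u h) (grad H)) (m h)" for h
  have Sv: "bounded_linear (\<lambda>v. S *v v)" by (rule matrix_vector_mul_bounded_linear)
  have C_F: "C_k 4 F"
    unfolding F_def by (rule C_k_linear_image[OF Sv], rule C_k_mono[OF C_grad]) simp
  have dF: "ddir v F p = S *v ddir v (grad H) p" for v p
    unfolding F_def
    by (rule fun_cong[OF ddir_linear_image[OF Sv, where k = 4]]) (use C_grad in \<open>simp del: C_k.simps\<close>)
  have ddF: "ddir v (ddir w F) p = S *v ddir v (ddir w (grad H)) p" for v w p
    unfolding dF
    by (rule fun_cong[OF ddir_linear_image[OF Sv, where k = 3]], rule C_k_ddir)
      (use C_grad in \<open>simp del: C_k.simps\<close>)
  note expansion = solution_midpoint_expansion[OF C_F y[folded F_def], folded z_def, folded m_def u_def]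
  have z_lim: "(z \<longlongrightarrow> x) (at 0)"
    using expansion(3) by (simp add: z_def[abs_def])
  from expansion(3) show "((\<lambda>h. y (t + h)) \<longlongrightarrow> x) (at 0)" by (simp add: z_def)
  have m_lim: "(m \<longlongrightarrow> x) (at 0)"
  proof -
    have "(m \<longlongrightarrow> (1/2) *\<^sub>R (x + x)) (at 0)"
      unfolding m_def[abs_def] by (intro tendsto_intros z_lim)
    then show ?thesis by (simp flip: scaleR_2)
  qed
  have u_lim: "(u \<longlongrightarrow> F x) (at 0)"
    using expansion(4) .
  have v1: "order_zero 1 (\<lambda>h. z h - x)"
  proof (rule order_zero_cong)
    show "order_zero 1 (\<lambda>h. h *\<^sub>R u h)"
      using order_zero_bilinear[OF bounded_bilinear_scaleR order_zero_power[of 1] order_zero_tendsto[OF u_lim]]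
      by simp
    show "h *\<^sub>R u h = z h - x" if "h \<noteq> 0" for h
      using that by (simp add: u_def)
  qed
  have \<Delta>_order: "order_zero 1 (\<lambda>h. \<Delta> (z h))"
  proof -
    have "C_k 1 \<Delta>"
      unfolding \<Delta>_def by (rule C_k_mono[OF C_Q_mat_difference]) simp
    from order_zero_Lipschitz[OF this z_lim tendsto_const v1]
    have "order_zero 1 (\<lambda>h. \<Delta> (z h) - \<Delta> x)" .
    moreover have "\<Delta> x = 0"
      by (simp add: \<Delta>_def scaleR_2 flip: scaleR_2) (simp add: scaleR_add_right flip: scaleR_add_left)
    ultimately show ?thesis by simp
  qed
  have N_order: "order_zero 0 N"
    unfolding N_def[abs_def] by (rule order_zero_tendsto[OF tendsto_C_k[OF C_hessian m_lim]])
  have \<Theta>_order: "order_zero 0 \<Theta>"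
  proof -
    have "C_k 3 (\<lambda>(p, u). ddir u (ddir u (grad H)) p)"
      by (rule C_k_second_derivative_diagonal) (use C_grad in \<open>simp del: C_k.simps\<close>)
    from tendsto_C_k[OF this tendsto_Pair[OF m_lim u_lim]] show ?thesis
      unfolding \<Theta>_def[abs_def] by (intro order_zero_tendsto) simp
  qed
  have correction: "order_zero 4 (\<lambda>h. g h + (1/2) *\<^sub>R (\<Delta> (z h) *v (z h - x)) - grad H (m h) - (h\<^sup>2 / 24) *\<^sub>R \<Theta> h)"
  proof -
    define R where "R h = g h + (1/2) *\<^sub>R (\<Delta> (z h) *v (z h - x)) - grad H (m h)
      - (1/24) *\<^sub>R ddir (z h - x) (ddir (z h - x) (grad H)) (m h)" for h
    obtain M where M: "\<forall>a\<in>cball x 1. \<forall>z\<in>cball x 1.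
       norm (DG a z
         + (1/2) *\<^sub>R ((Q_mat DG a ((1/3) *\<^sub>R (a + 2 *\<^sub>R z)) - Q_mat DG z ((1/3) *\<^sub>R (2 *\<^sub>R a + z))) *v (z - a))
         - grad H ((1/2) *\<^sub>R (a + z))
         - (1/24) *\<^sub>R ddir (z - a) (ddir (z - a) (grad H)) ((1/2) *\<^sub>R (a + z)))
       \<le> M * norm (z - a) ^ 4"
      using corrected_discrete_gradient_expansion[of x 1] by blast
    obtain C where C: "C > 0" "\<forall>\<^sub>F h in at 0. norm (z h - x) \<le> C * \<bar>h\<bar> ^ 1"
      using v1 by (rule order_zeroE)
    have "\<forall>\<^sub>F h in at 0. z h \<in> cball x 1"
      by (rule eventually_mono[OF tendstoD[OF z_lim, of 1]]) (simp_all add: dist_commute)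
    with C(2) have "\<forall>\<^sub>F h in at 0. norm (R h) \<le> (\<bar>M\<bar> * C ^ 4) * \<bar>h\<bar> ^ 4"
    proof eventually_elim
      case (elim h)
      have "norm (R h) \<le> M * norm (z h - x) ^ 4"
        unfolding R_def g_def \<Delta>_def m_def by (rule M[rule_format]) (use elim in auto)
      also have "\<dots> \<le> \<bar>M\<bar> * (C * \<bar>h\<bar>) ^ 4"
        using elim(1) by (intro mult_mono power_mono) auto
      finally show ?case by (simp add: power_mult_distrib mult.assoc)
    qed
    then have "order_zero 4 R" by (rule order_zeroI)
    then show ?thesis
    proof (rule order_zero_cong)
      fix h :: real assume h: "h \<noteq> 0"
      define q where "q u w = ddir u (ddir w (grad H)) (m h)" for u w
      have "bilinear q"
        unfolding q_def by (rule bilinear_second_derivative, rule C_k_mono[OF C_grad]) simp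
      then have "q (h *\<^sub>R u h) (h *\<^sub>R u h) = h\<^sup>2 *\<^sub>R q (u h) (u h)"
        by (simp add: bilinear_lmul bilinear_rmul power2_eq_square)
      moreover have "h *\<^sub>R u h = z h - x"
        using h by (simp add: u_def)
      ultimately show "R h = g h + (1/2) *\<^sub>R (\<Delta> (z h) *v (z h - x)) - grad H (m h) - (h\<^sup>2 / 24) *\<^sub>R \<Theta> h"
        by (simp add: R_def q_def \<Theta>_def)
    qed
  qed
  note matrix = order_zero_bilinear[OF bounded_bilinear_matrix_vector_mult]
  have g_grad: "order_zero 2 (\<lambda>h. g h - grad H (m h))"
  proof -
    have "order_zero 2 (\<lambda>h. (1/2) *\<^sub>R (\<Delta> (z h) *v (z h - x)))"
      using order_zero_scaleR[OF matrix[OF \<Delta>_order v1], where c = "1/2"] by (simp add: numeral_2_eq_2)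
    note X = this
    have T: "order_zero 2 (\<lambda>h. (h\<^sup>2 / 24) *\<^sub>R \<Theta> h)"
      using order_zero_square_scaleR[OF \<Theta>_order, of 24] by simp
    have R: "order_zero 2 (\<lambda>h. g h + (1/2) *\<^sub>R (\<Delta> (z h) *v (z h - x)) - grad H (m h) - (h\<^sup>2 / 24) *\<^sub>R \<Theta> h)"
      by (rule order_zero_mono[OF correction]) simp
    from order_zero_add[OF order_zero_diff[OF R X] T] show ?thesis by (simp add: algebra_simps)
  qed
  have Sg_u: "order_zero 2 (\<lambda>h. S *v g h - u h)"
    using order_zero_add[OF order_zero_linear[OF Sv g_grad] expansion(2)]
    by (simp add: F_def matrix_vector_mult_diff_distrib)
  have four: "order_zero 4 (\<lambda>h. u h - S4 S H DG x (z h) h *v g h)"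
  proof -
    have t1: "order_zero 4 (\<lambda>h. S *v (g h + (1/2) *\<^sub>R (\<Delta> (z h) *v (z h - x)) - grad H (m h) - (h\<^sup>2 / 24) *\<^sub>R \<Theta> h))"
      by (rule order_zero_linear[OF Sv correction])
    have t2: "order_zero 4 (\<lambda>h. (h / 2) *\<^sub>R (S *v (\<Delta> (z h) *v (S *v g h - u h))))"
      using order_zero_scaleR[OF order_zero_bilinear[OF bounded_bilinear_scaleR order_zero_power[of 1]
            order_zero_linear[OF Sv matrix[OF \<Delta>_order Sg_u]]], where c = "1/2"]
      by (simp add: eval_nat_numeral)
    have t3: "order_zero 4 (\<lambda>h. (h\<^sup>2 / 12) *\<^sub>R (S *v (N h *v (S *v (N h *v (S *v (g h - grad H (m h))))))))"
      using order_zero_square_scaleR[OF order_zero_linear[OF Sv matrix[OF N_order order_zero_linear[OF Sv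
                matrix[OF N_order order_zero_linear[OF Sv g_grad]]]]], of 12]
      by simp
    \<comment> \<open>The defect divided by \<open>h\<close>, written as four terms that are already known to be \<open>O(h\<^sup>4)\<close>.\<close>
    have sum: "order_zero 4 (\<lambda>h. (u h - F (m h) - (h\<^sup>2 / 24) *\<^sub>R ddir (u h) (ddir (u h) F) (m h)
          + (h\<^sup>2 / 12) *\<^sub>R ddir (ddir (F (m h)) F (m h)) F (m h))
        - S *v (g h + (1/2) *\<^sub>R (\<Delta> (z h) *v (z h - x)) - grad H (m h) - (h\<^sup>2 / 24) *\<^sub>R \<Theta> h)
        - (h / 2) *\<^sub>R (S *v (\<Delta> (z h) *v (S *v g h - u h)))
        + (h\<^sup>2 / 12) *\<^sub>R (S *v (N h *v (S *v (N h *v (S *v (g h - grad H (m h))))))))"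
      by (rule order_zero_add[OF order_zero_diff[OF order_zero_diff[OF expansion(1) t1] t2] t3])
    show ?thesis
    proof (rule order_zero_cong[OF sum])
      fix h :: real assume h: "h \<noteq> 0"
      have v: "z h - x = h *\<^sub>R u h" using h by (simp add: u_def)
      have S4_g: "S4 S H DG x (z h) h *v g h = S *v g h + (h / 2) *\<^sub>R (S *v (\<Delta> (z h) *v (S *v g h)))
          - (h\<^sup>2 / 12) *\<^sub>R (S *v (N h *v (S *v (N h *v (S *v g h)))))"
        by (simp add: S4_def \<Delta>_def N_def m_def matrix_vector_mult_diff_rdistrib matrix_vector_mult_add_rdistrib
            matrix_vector_mul_assoc matrix_mul_assoc scaleR_matrix_vector_assoc)
      have W: "ddir (ddir (F (m h)) F (m h)) F (m h) = S *v (N h *v (S *v (N h *v (S *v grad H (m h)))))"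
        by (simp only: dF N_def hessian_mult) (simp only: F_def)
      show "(u h - F (m h) - (h\<^sup>2 / 24) *\<^sub>R ddir (u h) (ddir (u h) F) (m h)
          + (h\<^sup>2 / 12) *\<^sub>R ddir (ddir (F (m h)) F (m h)) F (m h))
        - S *v (g h + (1/2) *\<^sub>R (\<Delta> (z h) *v (z h - x)) - grad H (m h) - (h\<^sup>2 / 24) *\<^sub>R \<Theta> h)
        - (h / 2) *\<^sub>R (S *v (\<Delta> (z h) *v (S *v g h - u h)))
        + (h\<^sup>2 / 12) *\<^sub>R (S *v (N h *v (S *v (N h *v (S *v (g h - grad H (m h)))))))
        = u h - S4 S H DG x (z h) h *v g h"
        unfolding S4_g W v ddF \<Theta>_def[symmetric]
        by (simp add: F_def matrix_vector_mult_diff_distrib matrix_vector_right_distrib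
            matrix_vector_mult_scaleR scaleR_diff_right scaleR_add_right)
    qed
  qed
  have "order_zero 5 (\<lambda>h. z h - x - h *\<^sub>R (S4 S H DG x (z h) h *v g h))"
  proof (rule order_zero_cong)
    show "order_zero 5 (\<lambda>h. h *\<^sub>R (u h - S4 S H DG x (z h) h *v g h))"
      using order_zero_bilinear[OF bounded_bilinear_scaleR order_zero_power[of 1] four] by simp
    show "h *\<^sub>R (u h - S4 S H DG x (z h) h *v g h) = z h - x - h *\<^sub>R (S4 S H DG x (z h) h *v g h)"
      if "h \<noteq> 0" for h
      using that by (simp add: u_def scaleR_diff_right)
  qed
  then show "order_zero 5 (\<lambda>h. y (t + h) - x - h *\<^sub>R (S4 S H DG x (y (t + h)) h *v DG x (y (t + h))))"
    by (simp add: z_def g_def)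
qed

lemma corrected_method_order_four:
  "has_order (\<lambda>x. S *v grad H x) (dg_method (S4 S H DG) DG) 4"
  unfolding has_order_def
proof (intro allI)
  fix x
  obtain \<phi> where step: "numerical_step (dg_method (S4 S H DG) DG) x \<phi>"
    and error: "\<And>k z. (z \<longlongrightarrow> x) (at 0) \<Longrightarrow>
      order_zero k (\<lambda>h. z h - x - h *\<^sub>R (case (z h, h) of (z, h) \<Rightarrow> S4 S H DG x z h *v DG x z)) \<Longrightarrow>
      order_zero k (\<lambda>h. \<phi> h - z h)"
    by (rule implicit_step[OF C_step_map, of "dg_method (S4 S H DG) DG" x S x])
      (simp_all add: dg_method_def)
  have "(\<lambda>h. norm (\<phi> h - y (t + h))) \<in> O[at 0](\<lambda>h. h ^ (4 + 1))"
    if "local_solution (\<lambda>x. S *v grad H x) y t x" for t y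
    using error[OF exact_solution_defect(1)[OF that], of 5] exact_solution_defect(2)[OF that]
    by (simp add: order_zero_def)
  with step show "\<exists>\<phi>. numerical_step (dg_method (S4 S H DG) DG) x \<phi> \<and>
      (\<forall>t y. local_solution (\<lambda>x. S *v grad H x) y t x \<longrightarrow>
        (\<lambda>h. norm (\<phi> h - y (t + h))) \<in> O[at 0](\<lambda>h. h ^ (4 + 1)))"
    by blast
qed

end

lemma transpose_canonical_S: "transpose canonical_S = - canonical_S"
  by (auto simp: transpose_def canonical_S_def vec_eq_iff split: sum.split)

theorem theorem2p1:
  fixes H :: "real^('d::finite + 'd) \<Rightarrow> real"
    and DG :: "real^('d + 'd) \<Rightarrow> real^('d + 'd) \<Rightarrow> real^('d + 'd)"
  assumes "C_k 5 H"
    and "C_k 5 (\<lambda>(x, z). DG x z)"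
    and "discrete_gradient H DG"
    and "symmetric_dg DG"
    and "second_order_dg canonical_S H DG"
  shows "(\<forall>x z h. transpose (S4 canonical_S H DG x z h) = - S4 canonical_S H DG x z h) \<and>
         has_order (\<lambda>x. canonical_S *v grad H x) (dg_method (S4 canonical_S H DG) DG) 4"
proof -
  interpret smooth_symmetric_discrete_gradient H DG
    by standard (fact assms)+
  show ?thesis
    using S4_skew[OF transpose_canonical_S] corrected_method_order_four by blast
qed

end
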